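(* Let $G$ be a 1-ended, 2-connected, bounded degree, non-amenable graph whose cycle space is generated by cycles of bounded length. Then $\dot p_c(G)<\frac{1}{h_V(G)+1}$.
   Context: $G$ is an infinite, connected, locally finite graph; 1-ended means that removing any finite subgraph leaves exactly one infinite component. The cycle space is the $\mathbb Z_2$-vector space of finite edge sets spanned by edge sets of cycles. For a finite vertex set $S$, $\partial_V S$ is the set of vertices outside $S$ having a neighbour in $S$, and $h_V(G)=\inf_S |\partial_V S|/|S|$ over finite non-empty $S$; non-amenable means the Cheeger constant is positive (equivalently, for bounded degree, $h_V(G)>0$). $\dot p_c(G)=\sup\{p:\Pr_p(|C_o|=\infty)=0\}$ is the critical threshold of Bernoulli site percolation, where $C_o$ is the cluster of a vertex $o$ in the subgraph induced by occupied vertices. *)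

theory Defs
  imports "HOL-Probability.Probability"
begin

definition graph :: "'a set \<Rightarrow> ('a \<Rightarrow> 'a \<Rightarrow> bool) \<Rightarrow> bool" where
  "graph V E \<longleftrightarrow> (\<forall>x y. E x y \<longrightarrow> E y x \<and> x \<noteq> y \<and> x \<in> V \<and> y \<in> V)"

definition induced :: "('a \<Rightarrow> 'a \<Rightarrow> bool) \<Rightarrow> 'a set \<Rightarrow> 'a \<Rightarrow> 'a \<Rightarrow> bool" where
  "induced E W x y \<longleftrightarrow> E x y \<and> x \<in> W \<and> y \<in> W"

definition connected_on :: "('a \<Rightarrow> 'a \<Rightarrow> bool) \<Rightarrow> 'a set \<Rightarrow> bool" where
  "connected_on E W \<longleftrightarrow> (\<forall>x\<in>W. \<forall>y\<in>W. (induced E W)\<^sup>*\<^sup>* x y)"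

definition neighbours :: "('a \<Rightarrow> 'a \<Rightarrow> bool) \<Rightarrow> 'a \<Rightarrow> 'a set" where
  "neighbours E v = {w. E v w}"

definition bounded_degree :: "'a set \<Rightarrow> ('a \<Rightarrow> 'a \<Rightarrow> bool) \<Rightarrow> bool" where
  "bounded_degree V E \<longleftrightarrow>
     (\<exists>D::nat. \<forall>v\<in>V. finite (neighbours E v) \<and> card (neighbours E v) \<le> D)"

definition components :: "('a \<Rightarrow> 'a \<Rightarrow> bool) \<Rightarrow> 'a set \<Rightarrow> 'a set set" where
  "components E W = {{y. (induced E W)\<^sup>*\<^sup>* x y} | x. x \<in> W}"

definition one_ended :: "'a set \<Rightarrow> ('a \<Rightarrow> 'a \<Rightarrow> bool) \<Rightarrow> bool" where
  "one_ended V E \<longleftrightarrow>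
     (\<forall>F. finite F \<longrightarrow> (\<exists>!C. C \<in> components E (V - F) \<and> infinite C))"

definition two_connected :: "'a set \<Rightarrow> ('a \<Rightarrow> 'a \<Rightarrow> bool) \<Rightarrow> bool" where
  "two_connected V E \<longleftrightarrow> (3 \<le> card V \<or> infinite V) \<and>
     connected_on E V \<and> (\<forall>v\<in>V. connected_on E (V - {v}))"

definition edge_set :: "('a \<Rightarrow> 'a \<Rightarrow> bool) \<Rightarrow> 'a set set" where
  "edge_set E = {{x, y} | x y. E x y}"

definition is_cycle :: "('a \<Rightarrow> 'a \<Rightarrow> bool) \<Rightarrow> 'a list \<Rightarrow> bool" where
  "is_cycle E cs \<longleftrightarrow> 3 \<le> length cs \<and> distinct cs \<and>
     (\<forall>i < length cs. E (cs ! i) (cs ! ((i + 1) mod length cs)))"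

definition cycle_edges :: "'a list \<Rightarrow> 'a set set" where
  "cycle_edges cs = {{cs ! i, cs ! ((i + 1) mod length cs)} | i. i < length cs}"

inductive_set z2span :: "'b set set \<Rightarrow> 'b set set" for S where
  zero: "{} \<in> z2span S"
| add: "A \<in> z2span S \<Longrightarrow> B \<in> S \<Longrightarrow> (A - B) \<union> (B - A) \<in> z2span S"

definition cycle_space :: "('a \<Rightarrow> 'a \<Rightarrow> bool) \<Rightarrow> 'a set set set" where
  "cycle_space E = z2span {cycle_edges cs | cs. is_cycle E cs}"

definition cycle_space_bounded_gen :: "('a \<Rightarrow> 'a \<Rightarrow> bool) \<Rightarrow> bool" where
  "cycle_space_bounded_gen E \<longleftrightarrow>
     (\<exists>k::nat. cycle_space E = z2span {cycle_edges cs | cs. is_cycle E cs \<and> length cs \<le> k})"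

definition vertex_boundary :: "'a set \<Rightarrow> ('a \<Rightarrow> 'a \<Rightarrow> bool) \<Rightarrow> 'a set \<Rightarrow> 'a set" where
  "vertex_boundary V E S = {v \<in> V - S. \<exists>u\<in>S. E u v}"

definition edge_boundary :: "('a \<Rightarrow> 'a \<Rightarrow> bool) \<Rightarrow> 'a set \<Rightarrow> ('a \<times> 'a) set" where
  "edge_boundary E S = {(u, v). u \<in> S \<and> v \<notin> S \<and> E u v}"

definition h_V :: "'a set \<Rightarrow> ('a \<Rightarrow> 'a \<Rightarrow> bool) \<Rightarrow> real" where
  "h_V V E = Inf {real (card (vertex_boundary V E S)) / real (card S) | S.
                  S \<subseteq> V \<and> finite S \<and> S \<noteq> {}}"

definition h_E :: "'a set \<Rightarrow> ('a \<Rightarrow> 'a \<Rightarrow> bool) \<Rightarrow> real" where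
  "h_E V E = Inf {real (card (edge_boundary E S)) / real (card S) | S.
                  S \<subseteq> V \<and> finite S \<and> S \<noteq> {}}"

definition nonamenable :: "'a set \<Rightarrow> ('a \<Rightarrow> 'a \<Rightarrow> bool) \<Rightarrow> bool" where
  "nonamenable V E \<longleftrightarrow> h_E V E > 0"

definition site_perc :: "'a set \<Rightarrow> real \<Rightarrow> ('a \<Rightarrow> bool) measure" where
  "site_perc V p = PiM V (\<lambda>_. measure_pmf (bernoulli_pmf p))"

definition cluster :: "'a set \<Rightarrow> ('a \<Rightarrow> 'a \<Rightarrow> bool) \<Rightarrow> ('a \<Rightarrow> bool) \<Rightarrow> 'a \<Rightarrow> 'a set" where
  "cluster V E \<omega> r = (if r \<in> V \<and> \<omega> r then
      {v. (induced E {x \<in> V. \<omega> x})\<^sup>*\<^sup>* r v} else {})"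

definition perc_infinite_prob :: "'a set \<Rightarrow> ('a \<Rightarrow> 'a \<Rightarrow> bool) \<Rightarrow> 'a \<Rightarrow> real \<Rightarrow> real" where
  "perc_infinite_prob V E r p =
     measure (site_perc V p) {\<omega> \<in> space (site_perc V p). infinite (cluster V E \<omega> r)}"

definition site_pc :: "'a set \<Rightarrow> ('a \<Rightarrow> 'a \<Rightarrow> bool) \<Rightarrow> 'a \<Rightarrow> real" where
  "site_pc V E r = Sup {p \<in> {0..1}. perc_infinite_prob V E r p = 0}"

end

theory Submission
  imports Defs
begin

text \<open>Write \<open>h\<close> for \<open>h_V V E\<close>, \<open>p\<^sub>0 = 1 / (1 + h)\<close> and \<open>bd S\<close> for the vertex boundary. The cluster of
  the root is a given finite connected set \<open>S\<close> with probability \<open>p ^ card S * (1 - p) ^ card (bd S)\<close>. If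
  there is almost surely no infinite cluster at \<open>p\<close>, these weights sum to \<open>p\<close>, while at any \<open>q\<close> they sum
  to at most \<open>q\<close>; comparing the weights at \<open>p > p\<^sub>0\<close> and at \<open>p\<^sub>0\<close> by means of \<open>card (bd S) \<ge> h * card S\<close>
  already gives a contradiction. The strict inequality comes from holes, i.e. vertices outside
  \<open>S\<close> all of whose neighbours lie in \<open>S\<close>: filling them gives the better bound
  \<open>card (bd S) \<ge> h * card S + (1 + h) * card (holes S)\<close>. Since the cycle space is generated by short
  cycles and no vertex is a cut vertex, the neighbours of a vertex \<open>v\<close> are connected to each other in a
  ball around \<open>v\<close> minus \<open>v\<close>, so a hole can be made at any non-root vertex of \<open>S\<close> by a bounded change.
  Making holes at arbitrary subsets of a separated set of linear size bounds
  \<open>\<Sum>S. w S * \<alpha> ^ (card S - 1)\<close> by \<open>\<Sum>S. w S * \<beta> ^ card (holes S)\<close>, and this gain extends the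
  contradiction to \<open>p\<close> slightly below \<open>p\<^sub>0\<close>.\<close>

subsection \<open>Short cycles and local connectivity\<close>

lemma even_card_symdiff:
  assumes "finite A" "finite B" "even (card A)" "even (card B)"
  shows "even (card ((A - B) \<union> (B - A)))"
proof -
  have "card ((A - B) \<union> (B - A)) = card (A - B) + card (B - A)"
    by (rule card_Un_disjoint) (use assms in auto)
  moreover have "card A = card (A \<inter> B) + card (A - B)" "card B = card (B \<inter> A) + card (B - A)"
    using assms by (simp_all add: card_Int_Diff)
  ultimately show ?thesis
    using assms by (metis Int_commute even_add)
qed

lemma mem_cycle_edges:
  "e \<in> cycle_edges cs \<longleftrightarrow> (\<exists>i. i < length cs \<and> e = {cs ! i, cs ! ((i + 1) mod length cs)})"
  unfolding cycle_edges_def by blast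

text \<open>Rotating the cycle to start at \<open>v\<close> and reading it periodically gives a
  function on all of \<open>nat\<close>, which frees later arguments from arithmetic modulo the
  length.\<close>

lemma cycle_unroll:
  assumes cyc: "is_cycle E cs" and v: "v \<in> set cs"
  shows "\<exists>f. f 0 = v \<and> f (length cs) = v \<and> inj_on f {..<length cs} \<and>
    (\<forall>j. E (f j) (f (Suc j))) \<and> cycle_edges cs = {{f j, f (Suc j)} | j. j < length cs}"
proof -
  define n where "n = length cs"
  have n: "n \<ge> 3" and dist: "distinct cs" and
    ed: "\<And>i. i < n \<Longrightarrow> E (cs ! i) (cs ! ((i + 1) mod n))"
    using cyc by (auto simp: is_cycle_def n_def)
  obtain i where i: "i < n" "cs ! i = v"
    using v by (auto simp: in_set_conv_nth n_def)
  define f where "f j = cs ! ((i + j) mod n)" for j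
  have suc: "f (Suc j) = cs ! (((i + j) mod n + 1) mod n)" for j
    by (simp add: f_def mod_Suc_eq)
  have "inj_on f {..<n}"
  proof (rule inj_onI)
    fix a b assume ab: "a \<in> {..<n}" "b \<in> {..<n}" "f a = f b"
    have "(i + a) mod n = (i + b) mod n"
      using ab(3) dist n by (simp add: f_def nth_eq_iff_index_eq n_def[symmetric])
    moreover have "(i + c) mod n = (if i + c < n then i + c else i + c - n)" if "c < n" for c
      using that i by (simp add: le_mod_geq)
    ultimately show "a = b" using ab i by (auto split: if_splits)
  qed
  moreover have "E (f j) (f (Suc j))" for j
    using ed[of "(i + j) mod n"] n suc[of j] by (simp add: f_def)
  moreover have "cycle_edges cs = {{f j, f (Suc j)} | j. j < n}"
  proof (intro equalityI subsetI)
    fix e assume "e \<in> cycle_edges cs"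
    then obtain l where l: "l < n" "e = {cs ! l, cs ! ((l + 1) mod n)}"
      by (auto simp: cycle_edges_def n_def)
    \<comment> \<open>The offset from \<open>i\<close> to \<open>l\<close> around the cycle;
      \<open>n\<close> is added so that the truncated subtraction is exact.\<close>
    define j where "j = (l + n - i) mod n"
    have "(i + j) mod n = (i + (l + n - i)) mod n"
      by (simp add: j_def mod_add_right_eq)
    also have "\<dots> = l" using l i by simp
    finally have "(i + j) mod n = l" .
    then have "e = {f j, f (Suc j)}" using l suc[of j] by (simp add: f_def)
    then show "e \<in> {{f j, f (Suc j)} | j. j < n}" using n by (auto simp: j_def)
  next
    fix e assume "e \<in> {{f j, f (Suc j)} | j. j < n}"
    then obtain j where "e = {f j, f (Suc j)}" by auto
    then show "e \<in> cycle_edges cs"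
      using n suc[of j] unfolding cycle_edges_def n_def[symmetric]
      by (auto simp: f_def intro!: exI[of _ "(i + j) mod n"])
  qed
  ultimately show ?thesis
    using i n by (intro exI[of _ f]) (simp add: f_def n_def)
qed

lemma distinct_path:
  assumes "R\<^sup>*\<^sup>* a b"
  obtains xs where "xs \<noteq> []" "hd xs = a" "last xs = b" "distinct xs" "successively R xs"
proof -
  have "\<exists>xs. xs \<noteq> [] \<and> hd xs = a \<and> last xs = b \<and> distinct xs \<and> successively R xs"
    using assms
  proof (induction rule: rtranclp_induct)
    case base
    show ?case by (rule exI[of _ "[a]"]) simp
  next
    case (step y z)
    then obtain xs where xs: "xs \<noteq> []" "hd xs = a" "last xs = y" "distinct xs" "successively R xs"
      by blast
    show ?case
    proof (cases "z \<in> set xs")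
      case True
      \<comment> \<open>Loop erasure: on reaching a vertex already visited, the path is cut back to
        it.\<close>
      then obtain ys zs where "xs = ys @ z # zs" by (meson split_list)
      then show ?thesis
        using xs by (intro exI[of _ "ys @ [z]"]) (auto simp: successively_append_iff hd_append)
    next
      case False
      then show ?thesis
        using xs step.hyps
        by (intro exI[of _ "xs @ [z]"]) (auto simp: successively_append_iff)
    qed
  qed
  then show ?thesis using that by blast
qed

section \<open>Walks in induced subgraphs and balls in the graph metric\<close>

lemma induced_mono:
  "W \<subseteq> W' \<Longrightarrow> (induced E W)\<^sup>*\<^sup>* x y \<Longrightarrow> (induced E W')\<^sup>*\<^sup>* x y"
  by (erule rtranclp_mono[THEN predicate2D, rotated]) (auto simp: induced_def)

lemma induced_path_in:
  "(induced E W)\<^sup>*\<^sup>* x y \<Longrightarrow> x \<in> W \<Longrightarrow> y \<in> W"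
  by (induction rule: rtranclp_induct) (auto simp: induced_def)

lemma induced_sym:
  assumes "graph V E" "(induced E W)\<^sup>*\<^sup>* x y"
  shows "(induced E W)\<^sup>*\<^sup>* y x"
proof -
  have "symp (induced E W)"
    using assms(1) by (auto simp: symp_def induced_def graph_def)
  then show ?thesis
    using assms(2) by (metis symp_rtranclp sympD)
qed

text \<open>The walk is stopped just before its first visit to \<open>v\<close>.\<close>

lemma induced_path_to_neighbour:
  assumes "(induced E W)\<^sup>*\<^sup>* x v" "x \<noteq> v"
  shows "\<exists>u. E u v \<and> u \<in> W - {v} \<and> (induced E (W - {v}))\<^sup>*\<^sup>* x u"
  using assms
proof (induction rule: converse_rtranclp_induct)
  case base
  then show ?case by simp
next
  case (step x y)
  show ?case
  proof (cases "y = v")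
    case True
    then show ?thesis using step by (intro exI[of _ x]) (auto simp: induced_def)
  next
    case False
    then obtain u where u: "E u v" "u \<in> W - {v}" "(induced E (W - {v}))\<^sup>*\<^sup>* y u"
      using step by blast
    have "induced E (W - {v}) x y" using step False by (auto simp: induced_def)
    then show ?thesis using u by (meson converse_rtranclp_into_rtranclp)
  qed
qed

primrec gball :: "('a \<Rightarrow> 'a \<Rightarrow> bool) \<Rightarrow> 'a \<Rightarrow> nat \<Rightarrow> 'a set" where
  "gball E v 0 = {v}"
| "gball E v (Suc n) = gball E v n \<union> (\<Union>u\<in>gball E v n. neighbours E u)"

lemma gball_mono: "m \<le> n \<Longrightarrow> gball E v m \<subseteq> gball E v n"
  by (induction n) (auto simp: le_Suc_eq)

lemma gball_self [simp]: "v \<in> gball E v n"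
  by (induction n) auto

lemma gball_Suc_front: "E v u \<Longrightarrow> x \<in> gball E u n \<Longrightarrow> x \<in> gball E v (Suc n)"
  by (induction n arbitrary: x) (auto simp: neighbours_def)

lemma gball_sym:
  assumes "graph V E" "x \<in> gball E v n"
  shows "v \<in> gball E x n"
  using assms(2)
proof (induction n arbitrary: x)
  case (Suc n)
  show ?case
  proof (cases "x \<in> gball E v n")
    case True
    then show ?thesis using Suc.IH by auto
  next
    case False
    then obtain u where "u \<in> gball E v n" "E u x" using Suc.prems by (auto simp: neighbours_def)
    then show ?thesis
      using Suc.IH[of u] gball_Suc_front[of E x u v n] assms(1) by (auto simp: graph_def)
  qed
qed auto

lemma gball_connected: "x \<in> gball E v n \<Longrightarrow> (induced E (gball E v n))\<^sup>*\<^sup>* v x"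
proof (induction n arbitrary: x)
  case (Suc n)
  show ?case
  proof (cases "x \<in> gball E v n")
    case True
    then show ?thesis using Suc.IH by (meson gball_mono induced_mono le_SucI order_refl)
  next
    case False
    then obtain u where u: "u \<in> gball E v n" "E u x" using Suc.prems by (auto simp: neighbours_def)
    have "(induced E (gball E v (Suc n)))\<^sup>*\<^sup>* v u"
      using Suc.IH[OF u(1)] by (meson gball_mono induced_mono le_SucI order_refl)
    moreover have "induced E (gball E v (Suc n)) u x"
      using u Suc.prems by (auto simp: induced_def)
    ultimately show ?thesis by (rule rtranclp.rtrancl_into_rtrancl)
  qed
qed auto

text \<open>A short cycle through \<open>v\<close> uses two edges at \<open>v\<close>, and the rest
  of it joins their other ends inside the ball without meeting \<open>v\<close>. Since
  \<open>X\<close> is closed under such connections, it contains both ends or neither.\<close>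

lemma even_card_cycle_edges:
  assumes cyc: "is_cycle E cs" "length cs \<le> k" and X: "X \<subseteq> neighbours E v"
    and closed: "\<And>c d. c \<in> X \<Longrightarrow> (induced E (gball E v k - {v}))\<^sup>*\<^sup>* c d \<Longrightarrow> E v d \<Longrightarrow> d \<in> X"
    and gr: "graph V E"
  shows "even (card {u \<in> X. {v, u} \<in> cycle_edges cs})"
proof (cases "v \<in> set cs")
  case False
  have "cs \<noteq> []" using cyc by (auto simp: is_cycle_def)
  then have "cs ! i \<noteq> v" if "i < length cs" for i
    using False that by (auto simp: in_set_conv_nth)
  moreover have "(i + 1) mod length cs < length cs" for i
    using \<open>cs \<noteq> []\<close> by simp
  ultimately have "{v, u} \<notin> cycle_edges cs" for u
    unfolding cycle_edges_def by (fastforce simp: doubleton_eq_iff)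
  then show ?thesis by simp
next
  case True
  define n where "n = length cs"
  obtain f where "f 0 = v \<and> f n = v \<and> inj_on f {..<n} \<and> (\<forall>j. E (f j) (f (Suc j))) \<and>
    cycle_edges cs = {{f j, f (Suc j)} | j. j < n}"
    using cycle_unroll[OF cyc(1) True, folded n_def] ..
  then have f: "f 0 = v" "f n = v" "inj_on f {..<n}" "\<And>j. E (f j) (f (Suc j))"
    "cycle_edges cs = {{f j, f (Suc j)} | j. j < n}"
    by simp_all
  have n: "3 \<le> n" "n \<le> k" using cyc by (auto simp: is_cycle_def n_def)
  have ne: "f j \<noteq> v" if "0 < j" "j < n" for j
    using inj_onD[OF f(3), of j 0] that f(1) by auto
  have ball: "f j \<in> gball E v j" for j
    by (induction j) (use f in \<open>auto simp: neighbours_def\<close>)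
  have path: "(induced E (gball E v k - {v}))\<^sup>*\<^sup>* (f 1) (f (Suc j))" if "Suc j < n" for j
    using that
  proof (induction j)
    case (Suc j)
    have "f (Suc j) \<in> gball E v k" "f (Suc (Suc j)) \<in> gball E v k"
      using ball[of "Suc j"] ball[of "Suc (Suc j)"] gball_mono[of "Suc j" k E v]
        gball_mono[of "Suc (Suc j)" k E v] Suc.prems n by auto
    then have "induced E (gball E v k - {v}) (f (Suc j)) (f (Suc (Suc j)))"
      using f(4) ne[of "Suc j"] ne[of "Suc (Suc j)"] Suc.prems by (auto simp: induced_def)
    then show ?case using Suc by (meson Suc_lessD rtranclp.rtrancl_into_rtrancl)
  qed simp
  define c d where "c = f 1" and "d = f (n - 1)"
  have cd: "(induced E (gball E v k - {v}))\<^sup>*\<^sup>* c d"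
    using path[of "n - 2"] n by (simp add: c_def d_def numeral_2_eq_2 Suc_diff_Suc)
  have dc: "(induced E (gball E v k - {v}))\<^sup>*\<^sup>* d c"
    using induced_sym[OF gr cd] .
  have E: "E v c" "E v d"
    using f(4)[of 0] f(4)[of "n - 1"] f(1,2) n gr by (auto simp: c_def d_def graph_def)
  \<comment> \<open>Length at least 3 keeps the two neighbours of \<open>v\<close> on the cycle
    distinct, so that the count is 2 and not 1.\<close>
  have "c \<noteq> d" using inj_onD[OF f(3), of 1 "n - 1"] n by (auto simp: c_def d_def)
  have iff: "{v, u} \<in> cycle_edges cs \<longleftrightarrow> u = c \<or> u = d" for u
  proof
    assume "{v, u} \<in> cycle_edges cs"
    then obtain j where j: "j < n" "{v, u} = {f j, f (Suc j)}" using f(5) by auto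
    then consider "v = f j" "u = f (Suc j)" | "v = f (Suc j)" "u = f j"
      by (auto simp: doubleton_eq_iff)
    then show "u = c \<or> u = d"
    proof cases
      case 1
      then have "j = 0" using ne[of j] j by auto
      then show ?thesis using 1 by (simp add: c_def)
    next
      case 2
      then have "Suc j = n" using ne[of "Suc j"] j by (metis Suc_lessI zero_less_Suc)
      then show ?thesis using 2 by (auto simp: d_def)
    qed
  next
    have "{v, c} = {f 0, f (Suc 0)}" using f by (simp add: c_def)
    moreover have "{v, d} = {f (n - 1), f (Suc (n - 1))}" using f n by (auto simp: d_def)
    moreover assume "u = c \<or> u = d"
    ultimately show "{v, u} \<in> cycle_edges cs"
      unfolding f(5) using n by (cases "u = c") (auto intro: exI[of _ 0] exI[of _ "n - 1"])
  qed
  have "c \<in> X \<longleftrightarrow> d \<in> X" using closed[OF _ cd] closed[OF _ dc] E by blast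
  then have "{u \<in> X. {v, u} \<in> cycle_edges cs} = (if c \<in> X then {c, d} else {})"
    using iff by auto
  then show ?thesis using \<open>c \<noteq> d\<close> by simp
qed

lemma z2span_even:
  assumes "A \<in> z2span S" "finite X"
    and "\<And>B. B \<in> S \<Longrightarrow> even (card {u \<in> X. {v, u} \<in> B})"
  shows "even (card {u \<in> X. {v, u} \<in> A})"
  using assms(1)
proof induction
  case zero
  show ?case by simp
next
  case (add A B)
  have "{u \<in> X. {v, u} \<in> A - B \<union> (B - A)} =
    ({u \<in> X. {v, u} \<in> A} - {u \<in> X. {v, u} \<in> B}) \<union> ({u \<in> X. {v, u} \<in> B} - {u \<in> X. {v, u} \<in> A})"
    by auto
  then show ?case
    using even_card_symdiff[of "{u \<in> X. {v, u} \<in> A}" "{u \<in> X. {v, u} \<in> B}"] add assms(2,3) by simp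
qed

lemma z2span_base: "B \<in> S \<Longrightarrow> B \<in> z2span S"
  using z2span.add[OF z2span.zero, of B S] by simp

text \<open>Let \<open>X\<close> be the neighbours of \<open>v\<close> reached from
  \<open>a\<close>. Every short cycle, hence every element of the cycle space, has an even number of
  edges from \<open>v\<close> to \<open>X\<close>. A path from \<open>a\<close> to \<open>b\<close>
  avoiding \<open>v\<close> exists because \<open>v\<close> is no cut vertex; it closes up through
  \<open>v\<close> to a cycle, and if \<open>b\<close> were outside \<open>X\<close>, only the edge
  to \<open>a\<close> would count.\<close>

lemma neighbours_connected_in_ball:
  assumes gr: "graph V E" and fin: "finite (neighbours E v)"
    and conn: "connected_on E (V - {v})"
    and gen: "cycle_space E = z2span {cycle_edges cs | cs. is_cycle E cs \<and> length cs \<le> k}"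
    and ab: "E v a" "E v b"
  shows "(induced E (gball E v k - {v}))\<^sup>*\<^sup>* a b"
proof (cases "a = b")
  case False
  define X where "X = {u. E v u \<and> (induced E (gball E v k - {v}))\<^sup>*\<^sup>* a u}"
  have Xsub: "X \<subseteq> neighbours E v" by (auto simp: X_def neighbours_def)
  have closed: "d \<in> X" if "c \<in> X" "(induced E (gball E v k - {v}))\<^sup>*\<^sup>* c d" "E v d" for c d
    using that by (auto simp: X_def)
  have even: "even (card {u \<in> X. {v, u} \<in> A})" if "A \<in> cycle_space E" for A
  proof (rule z2span_even)
    show "A \<in> z2span {cycle_edges cs | cs. is_cycle E cs \<and> length cs \<le> k}" using that gen by simp
    show "finite X" using Xsub fin by (rule finite_subset)
    fix B assume "B \<in> {cycle_edges cs | cs. is_cycle E cs \<and> length cs \<le> k}"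
    then obtain cs where cs: "B = cycle_edges cs" "is_cycle E cs" "length cs \<le> k" by blast
    show "even (card {u \<in> X. {v, u} \<in> B})"
      unfolding cs(1)
      by (rule even_card_cycle_edges[OF cs(2,3) Xsub closed gr])
  qed
  have "a \<in> V - {v}" "b \<in> V - {v}" using ab gr by (auto simp: graph_def)
  then have "(induced E (V - {v}))\<^sup>*\<^sup>* a b" using conn by (auto simp: connected_on_def)
  then obtain xs where xs: "xs \<noteq> []" "hd xs = a" "last xs = b" "distinct xs"
    "successively (induced E (V - {v})) xs" by (rule distinct_path)
  have len: "2 \<le> length xs"
    using xs(1-3) False by (cases xs rule: list.exhaust) (auto simp: Suc_le_eq)
  have step: "induced E (V - {v}) (xs ! i) (xs ! Suc i)" if "Suc i < length xs" for i
    using xs(5) that by (simp add: successively_conv_nth)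
  have vxs: "v \<notin> set xs"
  proof
    assume "v \<in> set xs"
    then obtain i where i: "i < length xs" "xs ! i = v" by (auto simp: in_set_conv_nth)
    show False
    proof (cases "Suc i < length xs")
      case True
      then show ?thesis using step[of i] i by (auto simp: induced_def)
    next
      case False
      then have "Suc (i - 1) = i" "Suc (i - 1) < length xs" using i len by auto
      then show ?thesis using step[of "i - 1"] i by (auto simp: induced_def)
    qed
  qed
  define cs where "cs = v # xs"
  have hdl: "xs ! 0 = a" "xs ! (length xs - 1) = b"
    using xs by (auto simp: hd_conv_nth last_conv_nth)
  have nth0: "cs ! 0 = v" "cs ! 1 = a" "cs ! length xs = b"
    using hdl xs(1) by (auto simp: cs_def nth_Cons split: nat.splits)
  have nthS: "cs ! Suc i = xs ! i" for i by (simp add: cs_def)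
  \<comment> \<open>The edge at index 0 leaves \<open>v\<close>, the one at index
    \<open>length xs\<close> returns to \<open>v\<close>, and the others are edges of the
    path.\<close>
  have cases: "P i" if "i < length cs" "P 0" "P (length xs)"
      "\<And>j. Suc j < length xs \<Longrightarrow> P (Suc j)" for i and P :: "nat \<Rightarrow> bool"
    using that by (cases i) (auto simp: cs_def less_Suc_eq)
  have is_cyc: "is_cycle E cs"
    unfolding is_cycle_def
  proof (intro conjI allI impI)
    show "3 \<le> length cs" "distinct cs" using len xs vxs by (auto simp: cs_def)
    fix i assume "i < length cs"
    then show "E (cs ! i) (cs ! ((i + 1) mod length cs))"
    proof (rule cases)
      have "(0 + 1) mod length cs = 1" using len xs(1) by (simp add: cs_def)
      then show "E (cs ! 0) (cs ! ((0 + 1) mod length cs))" using nth0 ab by simp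
      have "(length xs + 1) mod length cs = 0" by (simp add: cs_def)
      then show "E (cs ! length xs) (cs ! ((length xs + 1) mod length cs))"
        using nth0 ab gr by (simp add: graph_def)
      fix j assume "Suc j < length xs"
      then show "E (cs ! Suc j) (cs ! ((Suc j + 1) mod length cs))"
        using step[of j] by (simp add: cs_def induced_def)
    qed
  qed
  have inc: "u = a \<or> u = b" if vu: "{v, u} \<in> cycle_edges cs" for u
  proof -
    obtain i where "i < length cs \<and> {v, u} = {cs ! i, cs ! ((i + 1) mod length cs)}"
      using vu[unfolded mem_cycle_edges] ..
    then have i: "i < length cs" "{v, u} = {cs ! i, cs ! ((i + 1) mod length cs)}"
      by simp_all
    have "{v, u} = {cs ! i, cs ! ((i + 1) mod length cs)} \<longrightarrow> u = a \<or> u = b"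
      using i(1)
    proof (rule cases)
      have "(0 + 1) mod length cs = 1" using len xs(1) by (simp add: cs_def)
      then show "{v, u} = {cs ! 0, cs ! ((0 + 1) mod length cs)} \<longrightarrow> u = a \<or> u = b"
        using nth0 by (auto simp: doubleton_eq_iff)
      have "(length xs + 1) mod length cs = 0" by (simp add: cs_def)
      then show "{v, u} = {cs ! length xs, cs ! ((length xs + 1) mod length cs)} \<longrightarrow> u = a \<or> u = b"
        using nth0 by (auto simp: doubleton_eq_iff)
      fix j assume j: "Suc j < length xs"
      then have "xs ! j \<noteq> v" "xs ! Suc j \<noteq> v" using vxs by (auto simp: in_set_conv_nth)
      then show "{v, u} = {cs ! Suc j, cs ! ((Suc j + 1) mod length cs)} \<longrightarrow> u = a \<or> u = b"
        using j by (simp add: cs_def doubleton_eq_iff)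
    qed
    then show ?thesis using i(2) by blast
  qed
  have edge_a: "{v, a} \<in> cycle_edges cs"
  proof -
    have "(0 + 1) mod length cs = 1" "0 < length cs" using len xs(1) by (simp_all add: cs_def)
    then show ?thesis unfolding mem_cycle_edges using nth0 by (intro exI[of _ 0]) simp
  qed
  have edge_b: "{v, b} \<in> cycle_edges cs"
  proof -
    have "(length xs + 1) mod length cs = 0" "length xs < length cs" by (simp_all add: cs_def)
    then show ?thesis
      unfolding mem_cycle_edges using nth0 by (intro exI[of _ "length xs"]) (simp add: insert_commute)
  qed
  have "cycle_edges cs \<in> cycle_space E"
    unfolding cycle_space_def using is_cyc by (intro z2span_base) blast
  then have ev: "even (card {u \<in> X. {v, u} \<in> cycle_edges cs})" by (rule even)
  have "a \<in> X" using ab by (auto simp: X_def)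
  show ?thesis
  proof (rule ccontr)
    assume "\<not> ?thesis"
    then have "b \<notin> X" by (auto simp: X_def)
    then have "{u \<in> X. {v, u} \<in> cycle_edges cs} = {a}" using inc edge_a \<open>a \<in> X\<close> by auto
    then show False using ev by simp
  qed
qed simp

text \<open>A walk to \<open>v\<close>, stopped in time, ends at a neighbour of \<open>v\<close>.
  These neighbours are joined to each other in the ball, so deleting \<open>v\<close> after adding
  the ball disconnects nothing.\<close>

lemma connected_on_punch:
  assumes gr: "graph V E"
    and loc: "\<And>a b. E v a \<Longrightarrow> E v b \<Longrightarrow> (induced E (gball E v k - {v}))\<^sup>*\<^sup>* a b"
    and S: "connected_on E S" "v \<in> S"
  shows "connected_on E ((S \<union> gball E v k) - {v})"
proof -
  let ?S = "(S \<union> gball E v k) - {v}"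
  have nb: "\<exists>u. E v u \<and> (induced E ?S)\<^sup>*\<^sup>* x u" if x: "x \<in> ?S" for x
  proof -
    have "(induced E S)\<^sup>*\<^sup>* x v \<or> (induced E (gball E v k))\<^sup>*\<^sup>* x v"
      using x S gball_connected[of x E v k] induced_sym[OF gr]
      by (auto simp: connected_on_def)
    then obtain W where W: "(induced E W)\<^sup>*\<^sup>* x v" "W \<subseteq> S \<union> gball E v k" by blast
    then obtain u where u: "E u v" "(induced E (W - {v}))\<^sup>*\<^sup>* x u"
      using induced_path_to_neighbour[OF W(1)] x by blast
    have "(induced E ?S)\<^sup>*\<^sup>* x u" by (rule induced_mono[OF _ u(2)]) (use W in auto)
    then show ?thesis using u gr by (auto simp: graph_def)
  qed
  show ?thesis
    unfolding connected_on_def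
  proof (intro ballI)
    fix x y assume x: "x \<in> ?S" and y: "y \<in> ?S"
    obtain a where a: "E v a" "(induced E ?S)\<^sup>*\<^sup>* x a" using nb[OF x] by blast
    obtain b where b: "E v b" "(induced E ?S)\<^sup>*\<^sup>* y b" using nb[OF y] by blast
    have "(induced E ?S)\<^sup>*\<^sup>* a b" by (rule induced_mono[OF _ loc[OF a(1) b(1)]]) auto
    then show "(induced E ?S)\<^sup>*\<^sup>* x y"
      using a b induced_sym[OF gr b(2)] by (meson rtranclp_trans)
  qed
qed

subsection \<open>Holes in finite connected sets\<close>

lemma sum_power_card_Pow:
  fixes t :: real
  assumes "finite A"
  shows "(\<Sum>Q\<in>Pow A. t ^ card Q) = (1 + t) ^ card A"
  using assms
proof (induction A rule: finite_induct)
  case (insert a A)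
  have "(\<Sum>Q\<in>insert a ` Pow A. t ^ card Q) = (\<Sum>Q\<in>Pow A. t ^ card (insert a Q))"
    by (rule sum.reindex_cong[of "insert a"]) (use insert in \<open>auto simp: inj_on_def\<close>)
  also have "\<dots> = (\<Sum>Q\<in>Pow A. t * t ^ card Q)"
  proof (rule sum.cong)
    fix Q assume "Q \<in> Pow A"
    then have "finite Q" "a \<notin> Q" using insert finite_subset by auto
    then show "t ^ card (insert a Q) = t * t ^ card Q" by simp
  qed simp
  also have "\<dots> = t * (1 + t) ^ card A" by (simp add: insert sum_distrib_left[symmetric])
  finally have 1: "(\<Sum>Q\<in>insert a ` Pow A. t ^ card Q) = t * (1 + t) ^ card A" .
  have "(\<Sum>Q\<in>Pow (insert a A). t ^ card Q) =
      (\<Sum>Q\<in>Pow A. t ^ card Q) + (\<Sum>Q\<in>insert a ` Pow A. t ^ card Q)"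
    unfolding Pow_insert by (rule sum.union_disjoint) (use insert in auto)
  then show ?case using insert 1 by (simp add: algebra_simps)
qed simp

text \<open>\<open>local_connected\<close> carries what the short generating cycles and the absence
  of cut vertices provide. A positive \<open>k\<close> makes the ball contain all
  neighbours.\<close>

locale percolation_graph =
  fixes V :: "'a set" and E :: "'a \<Rightarrow> 'a \<Rightarrow> bool" and r :: 'a and D k :: nat
  assumes graph: "graph V E"
    and infinite_V: "infinite V"
    and connected: "connected_on E V"
    and finite_neighbours: "v \<in> V \<Longrightarrow> finite (neighbours E v)"
    and card_neighbours: "v \<in> V \<Longrightarrow> card (neighbours E v) \<le> D"
    and local_connected: "v \<in> V \<Longrightarrow> E v a \<Longrightarrow> E v b \<Longrightarrow>
      (induced E (gball E v k - {v}))\<^sup>*\<^sup>* a b"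
    and k_pos: "0 < k"
    and r_in_V: "r \<in> V"
begin

abbreviation bd :: "'a set \<Rightarrow> 'a set" where
  "bd \<equiv> vertex_boundary V E"

definition holes :: "'a set \<Rightarrow> 'a set" where
  "holes S = {v \<in> V - S. neighbours E v \<subseteq> S}"

text \<open>The possible finite clusters of an open root, known as lattice animals.\<close>

definition animals :: "'a set set" where
  "animals = {S. finite S \<and> S \<subseteq> V \<and> r \<in> S \<and> connected_on E S}"

text \<open>Keeps the ball that reroutes walks around one deleted point free of the other deleted
  points.\<close>

definition separated :: "'a set \<Rightarrow> bool" where
  "separated Q \<longleftrightarrow> (\<forall>u\<in>Q. \<forall>v\<in>Q. u \<noteq> v \<longrightarrow> u \<notin> gball E v k)"

text \<open>Meant to turn every point of a separated \<open>Q\<close> into a hole: the balls supply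
  its neighbours and the detours that keep the set connected.\<close>

definition punch :: "'a set \<Rightarrow> 'a set \<Rightarrow> 'a set" where
  "punch S Q = (S \<union> (\<Union>v\<in>Q. gball E v k)) - Q"

section \<open>Balls, boundaries and holes\<close>

lemma neighbour_in_V: "E u v \<Longrightarrow> v \<in> V" "E u v \<Longrightarrow> u \<in> V" "E u v \<Longrightarrow> E v u" "\<not> E u u"
  using graph by (auto simp: graph_def)

lemma has_neighbour:
  assumes "v \<in> V"
  shows "\<exists>u. E v u"
proof -
  have "infinite (V - {v})" using infinite_V by simp
  then obtain w where "w \<in> V" "w \<noteq> v" by (metis Diff_iff finite.emptyI ex_in_conv singletonI)
  then have "(induced E V)\<^sup>*\<^sup>* v w" "v \<noteq> w" using connected assms by (auto simp: connected_on_def)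
  then show ?thesis by (metis converse_rtranclpE induced_def)
qed

lemma gball_subset: "v \<in> V \<Longrightarrow> gball E v n \<subseteq> V"
  by (induction n) (auto simp: neighbours_def neighbour_in_V)

lemma finite_card_gball:
  assumes v: "v \<in> V"
  shows "finite (gball E v n) \<and> card (gball E v n) \<le> (D + 1) ^ n"
proof (induction n)
  case (Suc n)
  let ?B = "gball E v n"
  have sub: "?B \<subseteq> V" using gball_subset[OF v] .
  have fin: "finite (\<Union>u\<in>?B. neighbours E u)" using Suc sub finite_neighbours by auto
  have "card (\<Union>u\<in>?B. neighbours E u) \<le> (\<Sum>u\<in>?B. card (neighbours E u))"
    using Suc by (intro card_UN_le) auto
  also have "\<dots> \<le> (\<Sum>u\<in>?B. D)" using sub card_neighbours by (intro sum_mono) auto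
  also have "\<dots> = card ?B * D" by simp
  finally have "card (gball E v (Suc n)) \<le> card ?B + card ?B * D"
    using card_Un_le[of ?B "\<Union>u\<in>?B. neighbours E u"] by simp
  also have "\<dots> = card ?B * (D + 1)" by simp
  also have "\<dots> \<le> (D + 1) ^ n * (D + 1)" using Suc by (intro mult_right_mono) auto
  finally show ?case using Suc fin by (simp add: mult.commute)
qed simp

lemma finite_card_UN_gball:
  assumes "finite Q" "Q \<subseteq> V"
  shows "finite (\<Union>v\<in>Q. gball E v n)" "card (\<Union>v\<in>Q. gball E v n) \<le> card Q * (D + 1) ^ n"
proof -
  show "finite (\<Union>v\<in>Q. gball E v n)" using assms finite_card_gball by auto
  have "card (\<Union>v\<in>Q. gball E v n) \<le> (\<Sum>v\<in>Q. card (gball E v n))"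
    using assms by (intro card_UN_le) auto
  also have "\<dots> \<le> (\<Sum>v\<in>Q. (D + 1) ^ n)" using assms finite_card_gball by (intro sum_mono) auto
  finally show "card (\<Union>v\<in>Q. gball E v n) \<le> card Q * (D + 1) ^ n" by simp
qed

lemma finite_bd:
  assumes "finite S" "S \<subseteq> V"
  shows "finite (bd S)"
  by (rule finite_subset[of _ "\<Union>u\<in>S. neighbours E u"])
    (use assms finite_neighbours in \<open>auto simp: vertex_boundary_def neighbours_def\<close>)

text \<open>An isolated vertex would be a hole without touching \<open>S\<close>;
  \<open>has_neighbour\<close> excludes it.\<close>

lemma holes_subset_bd: "holes S \<subseteq> bd S"
  using has_neighbour neighbour_in_V(3)
  by (fastforce simp: holes_def vertex_boundary_def neighbours_def)

text \<open>Filling the holes of \<open>S\<close> removes them from the boundary and adds no new boundary vertex.\<close>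

lemma bd_holes_ge:
  fixes h :: real
  assumes iso: "\<And>S. finite S \<Longrightarrow> S \<noteq> {} \<Longrightarrow> S \<subseteq> V \<Longrightarrow> h * card S \<le> card (bd S)"
    and S: "finite S" "S \<noteq> {}" "S \<subseteq> V"
  shows "h * card S + (1 + h) * card (holes S) \<le> card (bd S)"
proof -
  let ?H = "holes S"
  have finH: "finite ?H" using finite_subset[OF holes_subset_bd finite_bd] S by blast
  have disj: "S \<inter> ?H = {}" and sub: "?H \<subseteq> V" by (auto simp: holes_def)
  have "bd (S \<union> ?H) \<subseteq> bd S - ?H"
    by (auto simp: vertex_boundary_def holes_def neighbours_def)
  then have "card (bd (S \<union> ?H)) \<le> card (bd S - ?H)"
    using finite_bd[OF S(1,3)] by (intro card_mono) auto
  also have "\<dots> = card (bd S) - card ?H"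
    using finH holes_subset_bd by (intro card_Diff_subset) auto
  finally have "card (bd (S \<union> ?H)) + card ?H \<le> card (bd S)"
    using card_mono[OF finite_bd[OF S(1,3)] holes_subset_bd] by simp
  moreover have "h * card (S \<union> ?H) \<le> card (bd (S \<union> ?H))"
    using S finH sub by (intro iso) auto
  moreover have "card (S \<union> ?H) = card S + card ?H"
    using S finH disj by (intro card_Un_disjoint) auto
  ultimately show ?thesis by (simp add: algebra_simps)
qed

section \<open>Separated sets and punching\<close>

lemma separated_subset: "separated Q \<Longrightarrow> Q' \<subseteq> Q \<Longrightarrow> separated Q'"
  by (auto simp: separated_def)

text \<open>For a separated \<open>T\<close> of greatest size the balls about \<open>T\<close> cover
  \<open>S - {r}\<close>, since an uncovered vertex could be added. The root is left out because it
  must survive the punching.\<close>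

lemma ex_large_separated:
  assumes S: "finite S" "S \<subseteq> V" "r \<in> S"
  shows "\<exists>T. T \<subseteq> S - {r} \<and> separated T \<and> card S - 1 \<le> card T * (D + 1) ^ k"
proof -
  let ?P = "\<lambda>T. T \<subseteq> S - {r} \<and> separated T"
  have "?P {}" by (simp add: separated_def)
  moreover have "\<forall>T. ?P T \<longrightarrow> card T < card S + 1"
    using S by (auto intro!: card_mono simp: less_Suc_eq_le)
  ultimately have "\<exists>T. ?P T \<and> (\<forall>T'. ?P T' \<longrightarrow> card T' \<le> card T)"
    by (rule ex_has_greatest_nat)
  then obtain T where "?P T \<and> (\<forall>T'. ?P T' \<longrightarrow> card T' \<le> card T)" ..
  then have T: "?P T" and max: "\<And>T'. ?P T' \<Longrightarrow> card T' \<le> card T"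
    by simp_all
  have finT: "finite T" and TV: "T \<subseteq> V" using T S by (auto intro: finite_subset)
  have "S - {r} \<subseteq> (\<Union>v\<in>T. gball E v k)"
  proof
    fix x assume x: "x \<in> S - {r}"
    show "x \<in> (\<Union>v\<in>T. gball E v k)"
    proof (rule ccontr)
      assume no: "x \<notin> (\<Union>v\<in>T. gball E v k)"
      then have "x \<notin> T" by auto
      have "separated (insert x T)"
        using T no gball_sym[OF graph] by (auto simp: separated_def)
      then have "card (insert x T) \<le> card T" using T x by (intro max) auto
      then show False using \<open>x \<notin> T\<close> finT by simp
    qed
  qed
  then have "card (S - {r}) \<le> card (\<Union>v\<in>T. gball E v k)"
    using finite_card_UN_gball(1)[OF finT TV] by (intro card_mono)
  also have "\<dots> \<le> card T * (D + 1) ^ k" by (rule finite_card_UN_gball(2)[OF finT TV])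
  finally show ?thesis using T S by auto
qed

text \<open>The points are punched one after another: by separation the ball of the next one brings
  back none of those already deleted, so the outcome of \<open>connected_on_punch\<close> is again a
  punched set.\<close>

lemma punch_connected:
  assumes "finite Q" "Q \<subseteq> S" "separated Q" "connected_on E S" "S \<subseteq> V"
  shows "connected_on E (punch S Q)"
  using assms(1,2,3)
proof (induction Q rule: finite_induct)
  case empty
  then show ?case using assms by (simp add: punch_def)
next
  case (insert v Q)
  have IH: "connected_on E (punch S Q)"
    using insert separated_subset by blast
  have "v \<in> punch S Q" "v \<in> V" using insert assms by (auto simp: punch_def)
  then have "connected_on E ((punch S Q \<union> gball E v k) - {v})"
    using local_connected by (intro connected_on_punch[OF graph _ IH]) auto
  moreover have "gball E v k \<inter> Q = {}"
    using insert by (auto simp: separated_def)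
  then have "(punch S Q \<union> gball E v k) - {v} = punch S (insert v Q)"
    by (auto simp: punch_def)
  ultimately show ?case by simp
qed

lemma punch_animal:
  assumes S: "S \<in> animals" and Q: "Q \<subseteq> S - {r}" "separated Q"
  shows "punch S Q \<in> animals"
proof -
  have S': "finite S" "S \<subseteq> V" "r \<in> S" "connected_on E S" using S by (auto simp: animals_def)
  have Q': "finite Q" "Q \<subseteq> V" "Q \<subseteq> S" using S' Q(1) by (auto intro: finite_subset)
  have "finite (punch S Q)"
    using S' finite_card_UN_gball(1)[OF Q'(1,2)] by (simp add: punch_def)
  moreover have "punch S Q \<subseteq> V"
    using S' Q' gball_subset unfolding punch_def by blast
  moreover have "connected_on E (punch S Q)"
    by (rule punch_connected[OF Q'(1,3) Q(2) S'(4,2)])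
  ultimately show ?thesis using S' Q unfolding animals_def punch_def by auto
qed

lemma neighbours_subset_gball: "neighbours E v \<subseteq> gball E v k"
  using gball_mono[of 1 k E v] k_pos by auto

lemma subset_holes_punch:
  assumes "Q \<subseteq> V" "separated Q"
  shows "Q \<subseteq> holes (punch S Q)"
proof
  fix v assume v: "v \<in> Q"
  have "u \<in> punch S Q" if "E v u" for u
  proof -
    have "u \<in> gball E v k" using neighbours_subset_gball that by (auto simp: neighbours_def)
    moreover from this have "u \<notin> Q"
      using assms(2) v that neighbour_in_V(4) unfolding separated_def by metis
    ultimately show ?thesis using v by (auto simp: punch_def)
  qed
  then show "v \<in> holes (punch S Q)"
    using v assms by (auto simp: holes_def neighbours_def punch_def)
qed

text \<open>Every vertex new to the set or to its boundary lies within distance \<open>k + 1\<close>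
  of \<open>Q\<close>: a new boundary vertex is in \<open>Q\<close> or adjacent to one of the added
  balls.\<close>

lemma card_punch:
  assumes S: "finite S" "S \<subseteq> V" and Q: "Q \<subseteq> S"
  shows "card (punch S Q) \<le> card S + card Q * (D + 1) ^ Suc k"
    and "card (bd (punch S Q)) \<le> card (bd S) + card Q * (D + 1) ^ Suc k"
proof -
  have Q': "finite Q" "Q \<subseteq> V" using assms by (auto intro: finite_subset)
  let ?U = "\<Union>v\<in>Q. gball E v (Suc k)"
  have U: "finite ?U" "card ?U \<le> card Q * (D + 1) ^ Suc k"
    using finite_card_UN_gball[OF Q', of "Suc k"] by auto
  have "punch S Q \<subseteq> S \<union> ?U" by (auto simp: punch_def)
  then have "card (punch S Q) \<le> card (S \<union> ?U)" using U S by (intro card_mono) auto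
  then show "card (punch S Q) \<le> card S + card Q * (D + 1) ^ Suc k"
    using U card_Un_le[of S ?U] by linarith
  have "bd (punch S Q) \<subseteq> bd S \<union> ?U"
  proof
    fix u assume u: "u \<in> bd (punch S Q)"
    show "u \<in> bd S \<union> ?U"
    proof (cases "u \<in> S")
      case True
      then have "u \<in> Q" using u by (auto simp: vertex_boundary_def punch_def)
      then show ?thesis by (intro UnI2 UN_I[of u] gball_self)
    next
      case False
      obtain w where w: "w \<in> punch S Q" "E w u" "u \<in> V" using u by (auto simp: vertex_boundary_def)
      show ?thesis
      proof (cases "w \<in> S")
        case True
        then show ?thesis using w False by (auto simp: vertex_boundary_def)
      next
        case False
        then obtain v where "v \<in> Q" "w \<in> gball E v k" using w by (auto simp: punch_def)
        then have "v \<in> Q" "u \<in> gball E v (Suc k)" using w by (auto simp: neighbours_def)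
        then show ?thesis by (intro UnI2 UN_I[of v])
      qed
    qed
  qed
  then have "card (bd (punch S Q)) \<le> card (bd S \<union> ?U)"
    using U finite_bd[OF S] by (intro card_mono) auto
  then show "card (bd (punch S Q)) \<le> card (bd S) + card Q * (D + 1) ^ Suc k"
    using U card_Un_le[of "bd S" ?U] by linarith
qed

text \<open>Punching forgets \<open>S\<close> only inside the balls about \<open>Q\<close>, so the
  trace of \<open>S\<close> there determines the preimage.\<close>

lemma card_punch_fibre:
  assumes "finite Z" and Z: "\<And>S Q. (S, Q) \<in> Z \<Longrightarrow> finite S \<and> S \<subseteq> V \<and> Q \<subseteq> S"
    and y: "y \<in> (\<lambda>(S, Q). (punch S Q, Q)) ` Z"
  shows "card {z \<in> Z. (\<lambda>(S, Q). (punch S Q, Q)) z = y} \<le> 2 ^ ((D + 1) ^ Suc k * card (snd y))"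
proof -
  obtain S' Q where y': "y = (S', Q)" by (cases y)
  obtain S where SQ: "(S, Q) \<in> Z" using y y' by auto
  have Q: "finite Q" "Q \<subseteq> V" using Z[OF SQ] by (auto intro: finite_subset)
  let ?U = "\<Union>v\<in>Q. gball E v k"
  have U: "finite ?U" "card ?U \<le> card Q * (D + 1) ^ k" using finite_card_UN_gball[OF Q] by auto
  have "Q \<subseteq> ?U" by (auto intro: gball_self)
  let ?A = "{z \<in> Z. (\<lambda>(S, Q). (punch S Q, Q)) z = y}"
  have "inj_on (\<lambda>z. fst z \<inter> ?U) ?A"
  proof (rule inj_onI)
    fix z z' assume z: "z \<in> ?A" "z' \<in> ?A" "fst z \<inter> ?U = fst z' \<inter> ?U"
    obtain A where A: "z = (A, Q)" "S' = (A \<union> ?U) - Q" using z(1) y' by (cases z) (auto simp: punch_def)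
    obtain B where B: "z' = (B, Q)" "S' = (B \<union> ?U) - Q" using z(2) y' by (cases z') (auto simp: punch_def)
    have "A - ?U = B - ?U" using A(2) B(2) \<open>Q \<subseteq> ?U\<close> by blast
    moreover have "A \<inter> ?U = B \<inter> ?U" using z(3) A B by simp
    ultimately have "A = B" by blast
    then show "z = z'" using A B by simp
  qed
  moreover have "(\<lambda>z. fst z \<inter> ?U) ` ?A \<subseteq> Pow ?U" by auto
  ultimately have "card ?A \<le> card (Pow ?U)" using U by (intro card_inj_on_le) auto
  also have "\<dots> = 2 ^ card ?U" using U by (simp add: card_Pow)
  \<comment> \<open>The exponent \<open>k\<close> is weakened to \<open>Suc k\<close> to agree with
    the constant in \<open>weight_punch\<close>.\<close>
  also have "\<dots> \<le> 2 ^ ((D + 1) ^ Suc k * card Q)"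
  proof (rule power_increasing)
    have "card Q * (D + 1) ^ k \<le> card Q * (D + 1) ^ Suc k"
      by (intro mult_le_mono2 power_increasing) auto
    then have "card ?U \<le> card Q * (D + 1) ^ Suc k" using U(2) by linarith
    then show "card ?U \<le> (D + 1) ^ Suc k * card Q" by (simp only: mult.commute)
  qed simp
  finally show ?thesis using y' by simp
qed

text \<open>For an animal \<open>S\<close>, \<open>x = p\<close> and \<open>y = 1 - p\<close> this
  is the probability that the cluster of the root is \<open>S\<close>. The parameters are
  independent because the comparison also needs \<open>x = p / \<alpha>\<close> with
  \<open>y = 1 - p\<close>.\<close>

definition weight :: "real \<Rightarrow> real \<Rightarrow> 'a set \<Rightarrow> real" where
  "weight x y S = x ^ card S * y ^ card (bd S)"

text \<open>Size and boundary grow by at most \<open>(D + 1) ^ Suc k\<close> per punched vertex, and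
  each extra vertex costs a factor \<open>x\<close> or \<open>y\<close>.\<close>

lemma weight_punch:
  assumes xy: "0 < x" "x \<le> 1" "0 < y" "y \<le> 1"
    and S: "finite S" "S \<subseteq> V" and Q: "Q \<subseteq> S"
  shows "weight x y S * ((x * y) ^ ((D + 1) ^ Suc k)) ^ card Q \<le> weight x y (punch S Q)"
proof -
  define b where "b = (D + 1) ^ Suc k"
  have "x ^ (card S + card Q * b) * y ^ (card (bd S) + card Q * b)
      \<le> x ^ card (punch S Q) * y ^ card (bd (punch S Q))"
    using card_punch[OF S Q] xy unfolding b_def[symmetric]
    by (intro mult_mono power_decreasing) auto
  also have "x ^ (card S + card Q * b) * y ^ (card (bd S) + card Q * b) =
      weight x y S * ((x * y) ^ b) ^ card Q"
    by (simp add: weight_def power_add power_mult_distrib power_mult[symmetric] mult_ac)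
  finally show ?thesis unfolding weight_def b_def .
qed

text \<open>A finite-energy argument: each animal \<open>S\<close> carries many separated places, and any set \<open>Q\<close> of
  them can be turned into holes at a cost exponential in \<open>card Q\<close>; the holes remember \<open>Q\<close>, so few
  animals are mapped to the same pair.\<close>

lemma sum_weight_le_sum_holes:
  fixes x y \<alpha> K :: real and N :: nat
  assumes xy: "0 < x" "x \<le> 1" "0 < y" "y \<le> 1" and \<alpha>: "1 \<le> \<alpha>"
    and N: "(D + 1) ^ k \<le> N"
    and K: "2 ^ ((D + 1) ^ Suc k) / (x * y) ^ ((D + 1) ^ Suc k) \<le> K"
    and F: "finite F" "F \<subseteq> animals"
  shows "\<exists>F'. finite F' \<and> F' \<subseteq> animals \<and>
    (\<Sum>S\<in>F. weight x y S * \<alpha> ^ (card S - 1)) \<le>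
    (\<Sum>S\<in>F'. weight x y S * (1 + K * (\<alpha> ^ N - 1)) ^ card (holes S))"
proof -
  define b where "b = (D + 1) ^ Suc k"
  define t where "t = \<alpha> ^ N - 1"
  define \<kappa> where "\<kappa> = (x * y) ^ b"
  have t: "0 \<le> t" using \<alpha> by (simp add: t_def one_le_power)
  have \<kappa>: "0 < \<kappa>" using xy by (simp add: \<kappa>_def)
  have w0: "0 \<le> weight x y S" for S using xy by (simp add: weight_def)
  have an: "finite S" "S \<subseteq> V" "r \<in> S" if "S \<in> F" for S
    using F that by (auto simp: animals_def)
  have "\<forall>S\<in>F. \<exists>T. T \<subseteq> S - {r} \<and> separated T \<and> card S - 1 \<le> card T * (D + 1) ^ k"
    using ex_large_separated[OF an] by simp
  then obtain T where "\<forall>S\<in>F. T S \<subseteq> S - {r} \<and> separated (T S) \<and> card S - 1 \<le> card (T S) * (D + 1) ^ k"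
    by (rule bchoice[THEN exE])
  then have T: "\<And>S. S \<in> F \<Longrightarrow> T S \<subseteq> S - {r}" "\<And>S. S \<in> F \<Longrightarrow> separated (T S)"
    "\<And>S. S \<in> F \<Longrightarrow> card S - 1 \<le> card (T S) * (D + 1) ^ k"
    by simp_all
  have finT: "finite (T S)" if "S \<in> F" for S
    using T(1)[OF that] an(1)[OF that] by (meson finite_Diff finite_subset)
  define Z where "Z = Sigma F (\<lambda>S. Pow (T S))"
  define g where "g = (\<lambda>(S, Q). (punch S Q, Q :: 'a set))"
  define G where "G = (\<lambda>(S, Q :: 'a set). weight x y S * (t / \<kappa>) ^ card Q)"
  define F' where "F' = fst ` g ` Z"
  have finZ: "finite Z" using F finT by (auto simp: Z_def)
  have ZD: "S \<in> F \<and> Q \<subseteq> S - {r} \<and> separated Q" if "(S, Q) \<in> Z" for S Q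
    using that T(1)[of S] T(2)[of S] separated_subset[of "T S" Q] by (auto simp: Z_def)
  have F'_an: "F' \<subseteq> animals"
  proof
    fix A assume "A \<in> F'"
    then obtain S Q where "(S, Q) \<in> Z" "A = punch S Q" by (auto simp: F'_def g_def)
    then show "A \<in> animals" using ZD[of S Q] punch_animal[of S Q] F by auto
  qed
  have finF': "finite F'" using finZ by (simp add: F'_def)
  have finH: "finite (holes A)" if "A \<in> F'" for A
    using that F'_an finite_subset[OF holes_subset_bd finite_bd] by (auto simp: animals_def)
  have image_sub: "g ` Z \<subseteq> Sigma F' (\<lambda>A. Pow (holes A))"
  proof
    fix z assume z: "z \<in> g ` Z"
    then obtain S Q where SQ: "(S, Q) \<in> Z" "z = (punch S Q, Q)" by (auto simp: g_def)
    have "punch S Q \<in> F'" unfolding F'_def by (rule image_eqI[OF _ z]) (simp add: SQ(2))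
    moreover have "Q \<subseteq> holes (punch S Q)"
      using ZD[OF SQ(1)] an(2)[of S] by (intro subset_holes_punch) blast+
    ultimately show "z \<in> Sigma F' (\<lambda>A. Pow (holes A))" using SQ(2) by simp
  qed
  \<comment> \<open>The linear size of \<open>T S\<close> bounds
    \<open>\<alpha> ^ (card S - 1)\<close> by a power of \<open>1 + t = \<alpha> ^ N\<close>, which
    is then expanded binomially over the subsets \<open>Q\<close> of \<open>T S\<close>.\<close>
  have "(\<Sum>S\<in>F. weight x y S * \<alpha> ^ (card S - 1)) \<le> (\<Sum>S\<in>F. weight x y S * (1 + t) ^ card (T S))"
  proof (intro sum_mono mult_left_mono w0)
    fix S assume "S \<in> F"
    then have "card S - 1 \<le> card (T S) * N"
      using T(3)[of S] N by (meson mult_le_mono2 order_trans)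
    then have "\<alpha> ^ (card S - 1) \<le> \<alpha> ^ (card (T S) * N)" using \<alpha> by (rule power_increasing)
    also have "\<dots> = (1 + t) ^ card (T S)" by (simp add: t_def power_mult[symmetric] mult.commute)
    finally show "\<alpha> ^ (card S - 1) \<le> (1 + t) ^ card (T S)" .
  qed
  also have "\<dots> = (\<Sum>S\<in>F. \<Sum>Q\<in>Pow (T S). weight x y S * t ^ card Q)"
    using finT by (intro sum.cong) (simp_all add: sum_power_card_Pow[symmetric] sum_distrib_left)
  also have "\<dots> = (\<Sum>(S, Q)\<in>Z. weight x y S * t ^ card Q)"
    unfolding Z_def using F finT by (intro sum.Sigma) auto
  \<comment> \<open>Punching costs at most a factor \<open>\<kappa>\<close> per vertex of
    \<open>Q\<close>, and the factor \<open>t / \<kappa>\<close> in \<open>G\<close> pays for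
    it.\<close>
  also have "\<dots> \<le> (\<Sum>z\<in>Z. G (g z))"
  proof (rule sum_mono)
    fix z assume z: "z \<in> Z"
    obtain S Q where SQ: "z = (S, Q)" by (cases z)
    have S: "finite S" "S \<subseteq> V" "Q \<subseteq> S" using ZD z SQ an by auto
    have "weight x y S * \<kappa> ^ card Q * (t / \<kappa>) ^ card Q \<le> weight x y (punch S Q) * (t / \<kappa>) ^ card Q"
      using weight_punch[OF xy S] t \<kappa> unfolding \<kappa>_def b_def by (intro mult_right_mono) auto
    moreover have "\<kappa> ^ card Q * (t / \<kappa>) ^ card Q = t ^ card Q"
      using \<kappa> by (simp add: power_mult_distrib[symmetric])
    ultimately show "(case z of (S, Q) \<Rightarrow> weight x y S * t ^ card Q) \<le> G (g z)"
      by (simp add: SQ G_def g_def mult.assoc)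
  qed
  \<comment> \<open>Pairs are grouped by their image; the bound \<open>2 ^ (b * card Q)\<close> on
    the multiplicity is later absorbed, together with \<open>1 / \<kappa>\<close>, into
    \<open>K\<close>.\<close>
  also have "\<dots> = (\<Sum>y\<in>g ` Z. \<Sum>z\<in>{z \<in> Z. g z = y}. G (g z))"
    using finZ by (rule sum.image_gen)
  also have "\<dots> = (\<Sum>y\<in>g ` Z. card {z \<in> Z. g z = y} * G y)"
    by (intro sum.cong) auto
  also have "\<dots> \<le> (\<Sum>y\<in>g ` Z. 2 ^ (b * card (snd y)) * G y)"
  proof (intro sum_mono mult_right_mono)
    fix y assume y: "y \<in> g ` Z"
    have "finite S \<and> S \<subseteq> V \<and> Q \<subseteq> S" if "(S, Q) \<in> Z" for S Q
      using ZD[OF that] an by auto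
    then have "card {z \<in> Z. g z = y} \<le> 2 ^ (b * card (snd y))"
      using y unfolding g_def b_def by (intro card_punch_fibre[OF finZ])
    then have "real (card {z \<in> Z. g z = y}) \<le> real (2 ^ (b * card (snd y)))"
      using of_nat_le_iff by blast
    then show "real (card {z \<in> Z. g z = y}) \<le> 2 ^ (b * card (snd y))" by simp
    show "0 \<le> G y" using w0 t \<kappa> by (cases y) (simp add: G_def)
  qed
  also have "\<dots> \<le> (\<Sum>z\<in>g ` Z. case z of (A, Q) \<Rightarrow> weight x y A * (K * t) ^ card Q)"
  proof (rule sum_mono)
    fix z assume "z \<in> g ` Z"
    obtain A Q where AQ: "z = (A, Q)" by (cases z)
    have "2 ^ (b * card Q) * (t / \<kappa>) ^ card Q = (2 ^ b / \<kappa> * t) ^ card Q"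
      by (simp add: power_mult power_mult_distrib power_divide)
    also have "\<dots> \<le> (K * t) ^ card Q"
      using K t \<kappa> unfolding b_def[symmetric] \<kappa>_def[symmetric]
      by (intro power_mono mult_right_mono) auto
    finally have "weight x y A * (2 ^ (b * card Q) * (t / \<kappa>) ^ card Q) \<le> weight x y A * (K * t) ^ card Q"
      using w0 by (intro mult_left_mono)
    then show "2 ^ (b * card (snd z)) * G z \<le> (case z of (A, Q) \<Rightarrow> weight x y A * (K * t) ^ card Q)"
      by (simp add: AQ G_def mult.left_commute)
  qed
  \<comment> \<open>Allowing all subsets of the holes of \<open>A\<close> completes the inner sum to
    a binomial expansion.\<close>
  also have "\<dots> \<le> (\<Sum>(A, Q)\<in>Sigma F' (\<lambda>A. Pow (holes A)). weight x y A * (K * t) ^ card Q)"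
  proof (rule sum_mono2[OF _ image_sub])
    show "finite (Sigma F' (\<lambda>A. Pow (holes A)))" using finF' finH by auto
    have "0 \<le> 2 ^ b / \<kappa>" using \<kappa> by simp
    then have "0 \<le> K" using K unfolding b_def \<kappa>_def by linarith
    then show "0 \<le> (case z of (A, Q) \<Rightarrow> weight x y A * (K * t) ^ card Q)" for z
      using t w0 by (cases z) simp
  qed
  also have "\<dots> = (\<Sum>A\<in>F'. \<Sum>Q\<in>Pow (holes A). weight x y A * (K * t) ^ card Q)"
    using finF' finH by (intro sum.Sigma[symmetric]) auto
  also have "\<dots> = (\<Sum>A\<in>F'. weight x y A * (1 + K * t) ^ card (holes A))"
    using finH by (intro sum.cong) (simp_all add: sum_power_card_Pow[symmetric] sum_distrib_left)
  finally show ?thesis using finF' F'_an unfolding t_def by blast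
qed

end

subsection \<open>Comparing weights\<close>

text \<open>At the first order in \<open>\<alpha> - 1\<close>, with \<open>p = 1 / (1 + h)\<close>: the tilt by \<open>s\<close> changes
  \<open>p * s powr - h\<close> and \<open>q\<close> by the same amount, which leaves the factor \<open>\<alpha>\<close> as the gain.\<close>

lemma tilt_parameters:
  fixes h K :: real and N :: nat
  defines "p0 \<equiv> 1 / (1 + h)"
  defines "s \<equiv> \<lambda>a. (1 + K * (a ^ N - 1)) powr (1 / (1 + h))"
  assumes h: "0 < h" and K: "0 < K" and N: "1 + h < h * K * N"
  obtains \<alpha> \<delta> where "1 < \<alpha>" "\<alpha> \<le> 2" "0 < \<delta>" "\<delta> \<le> p0 / 2"
    "\<And>p. p0 - \<delta> < p \<Longrightarrow> p \<le> p0 \<Longrightarrow> p / \<alpha> * s \<alpha> powr - h \<le> 1 - (1 - p) * s \<alpha>"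
    "\<And>p. p0 - \<delta> < p \<Longrightarrow> p \<le> p0 \<Longrightarrow> \<alpha> * (1 - (1 - p) * s \<alpha>) < p"
proof -
  have p0: "0 < p0" "p0 < 1" "1 - p0 = h * p0" using h by (auto simp: p0_def field_simps)
  define \<sigma> where "\<sigma> = K * N / (1 + h)"
  have s1: "s 1 = 1" by (simp add: s_def)
  have ds: "(s has_real_derivative \<sigma>) (at 1)"
    unfolding s_def \<sigma>_def
    by (rule derivative_eq_intros refl | simp)+
  \<comment> \<open>Both differences vanish at \<open>a = 1\<close>, so a positive derivative makes
    them positive just to the right. Here the terms in \<open>\<sigma>\<close> cancel because
    \<open>1 - p0 = h * p0\<close>; in \<open>d2\<close> they remain, and the assumption on
    \<open>N\<close> gives the sign.\<close>
  have d1: "((\<lambda>a. 1 - (1 - p0) * s a - p0 / a * s a powr - h) has_real_derivative p0) (at 1)"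
    by (rule derivative_eq_intros ds refl | simp add: s1)+ (use p0(3) in \<open>simp add: algebra_simps\<close>)
  have d2: "((\<lambda>a. p0 - a * (1 - (1 - p0) * s a)) has_real_derivative p0 * (h * \<sigma> - 1)) (at 1)"
    by (rule derivative_eq_intros ds refl | simp add: s1)+ (use p0(3) in algebra)
  have "1 < h * \<sigma>" using N h by (simp add: \<sigma>_def field_simps)
  then have pos2: "0 < p0 * (h * \<sigma> - 1)" using p0 by simp
  obtain e1 where e1: "e1 > 0"
    "\<And>u. 0 < u \<Longrightarrow> u < e1 \<Longrightarrow> 0 < 1 - (1 - p0) * s (1 + u) - p0 / (1 + u) * s (1 + u) powr - h"
    using DERIV_pos_inc_right[OF d1 p0(1)] by (auto simp: s1)
  obtain e2 where e2: "e2 > 0"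
    "\<And>u. 0 < u \<Longrightarrow> u < e2 \<Longrightarrow> 0 < p0 - (1 + u) * (1 - (1 - p0) * s (1 + u))"
    using DERIV_pos_inc_right[OF d2 pos2] by (auto simp: s1)
  define u where "u = min 1 (min e1 e2 / 2)"
  have u: "0 < u" "u < e1" "u < e2" "u \<le> 1" using e1(1) e2(1) by (auto simp: u_def)
  define \<alpha> where "\<alpha> = 1 + u"
  define f where "f p = 1 - (1 - p) * s \<alpha> - p / \<alpha> * s \<alpha> powr - h" for p
  define g where "g p = p - \<alpha> * (1 - (1 - p) * s \<alpha>)" for p
  have f0: "0 < f p0" using e1(2)[OF u(1,2)] by (simp add: f_def \<alpha>_def)
  have g0: "0 < g p0" using e2(2)[OF u(1,3)] by (simp add: g_def \<alpha>_def)
  \<comment> \<open>With \<open>\<alpha>\<close> fixed, both inequalities are strict at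
    \<open>p0\<close>, so continuity in \<open>p\<close> extends them to a neighbourhood.\<close>
  have "isCont f p0" "isCont g p0"
    unfolding f_def g_def by (auto intro!: continuous_intros simp: \<alpha>_def u(1) add_pos_pos less_imp_neq[symmetric])
  then have "\<forall>\<^sub>F p in nhds p0. 0 < f p \<and> 0 < g p"
    using f0 g0 by (intro eventually_conj) (auto simp: continuous_at tendsto_at_iff_tendsto_nhds dest: order_tendstoD)
  then obtain d where d: "d > 0" "\<And>p. dist p p0 < d \<Longrightarrow> 0 < f p \<and> 0 < g p"
    unfolding eventually_nhds_metric by blast
  show ?thesis
  proof
    show "1 < \<alpha>" "\<alpha> \<le> 2" using u by (auto simp: \<alpha>_def)
    show "0 < min d (p0 / 2)" "min d (p0 / 2) \<le> p0 / 2" using d p0 by auto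
    fix p assume "p0 - min d (p0 / 2) < p" "p \<le> p0"
    then have "dist p p0 < d" by (auto simp: dist_real_def)
    then have "0 < f p" "0 < g p" using d(2) by auto
    then show "p / \<alpha> * s \<alpha> powr - h \<le> 1 - (1 - p) * s \<alpha>" "\<alpha> * (1 - (1 - p) * s \<alpha>) < p"
      by (auto simp: f_def g_def)
  qed
qed

text \<open>Unless \<open>n = m = 0\<close>, the function \<open>p ^ n * (1 - p) ^ m\<close> peaks
  at \<open>n / (n + m)\<close>, which is at most \<open>p0\<close>. The comparison beyond
  \<open>p0\<close> follows from the tangent bounds for \<open>ln\<close> at \<open>p0\<close> and
  at \<open>1 - p0\<close>.\<close>

lemma weight_decreasing:
  fixes h p :: real and n m :: nat
  defines "p0 \<equiv> 1 / (1 + h)"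
  assumes h: "0 < h" and p: "p0 \<le> p" "p \<le> 1" and nm: "h * n \<le> m"
  shows "p ^ n * (1 - p) ^ m \<le> p0 ^ n * (1 - p0) ^ m"
proof -
  have p0: "0 < p0" "p0 < 1" "1 - p0 = h * p0" using h by (auto simp: p0_def field_simps)
  \<comment> \<open>Logarithms of \<open>1 - p\<close> are used only for \<open>p < 1\<close>. At
    \<open>p = 1\<close>, \<open>n \<noteq> 0\<close> forces \<open>m \<noteq> 0\<close> and the
    left side vanishes.\<close>
  consider "n = 0" | "p = 1" "n \<noteq> 0" | "p < 1" using p by linarith
  then show ?thesis
  proof cases
    case 1
    then show ?thesis using p p0 by (simp add: power_mono)
  next
    case 2
    then have "0 < h * n" using h by simp
    then have "m \<noteq> 0" using nm by (metis less_le_not_le of_nat_0)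
    then show ?thesis using 2 p0 h by (simp add: zero_power)
  next
    case 3
    have "ln p - ln p0 \<le> (p - p0) / p0" using p p0 by (intro ln_diff_le) auto
    then have "n * (ln p - ln p0) \<le> n * ((p - p0) / p0)" by (intro mult_left_mono) auto
    \<comment> \<open>The identity \<open>1 - p0 = h * p0\<close> exchanges the slope
      \<open>1 / p0\<close> for \<open>1 / (1 - p0)\<close> at the price of a factor
      \<open>h\<close>, which \<open>h * n \<le> m\<close> then absorbs.\<close>
    also have "\<dots> = h * n * ((p - p0) / (1 - p0))" unfolding p0(3) using p0(1) h by (simp add: field_simps)
    also have "\<dots> \<le> m * ((p - p0) / (1 - p0))" using nm p p0 by (intro mult_right_mono) auto
    also have "\<dots> \<le> m * (ln (1 - p0) - ln (1 - p))"
    proof (rule mult_left_mono)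
      have "ln (1 - p) - ln (1 - p0) \<le> ((1 - p) - (1 - p0)) / (1 - p0)"
        using 3 p0 by (intro ln_diff_le) auto
      also have "\<dots> = - ((p - p0) / (1 - p0))" by (simp add: minus_divide_left)
      finally show "(p - p0) / (1 - p0) \<le> ln (1 - p0) - ln (1 - p)" by simp
    qed simp
    finally have "n * ln p + m * ln (1 - p) \<le> n * ln p0 + m * ln (1 - p0)"
      by (simp add: right_diff_distrib)
    then have "ln (p ^ n * (1 - p) ^ m) \<le> ln (p0 ^ n * (1 - p0) ^ m)"
      using 3 p p0(1,2) by (simp add: ln_mult ln_realpow)
    then show ?thesis using 3 p p0 by (subst (asm) ln_le_cancel_iff) auto
  qed
qed

subsection \<open>Site percolation\<close>

lemma site_perc_cylinder:
  assumes AB: "finite A" "finite B" "A \<subseteq> V" "B \<subseteq> V" "A \<inter> B = {}" and p: "0 \<le> p" "p \<le> 1"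
  defines "C \<equiv> {\<omega> \<in> space (site_perc V p). (\<forall>v\<in>A. \<omega> v) \<and> (\<forall>v\<in>B. \<not> \<omega> v)}"
  shows "C \<in> sets (site_perc V p)" and "measure (site_perc V p) C = p ^ card A * (1 - p) ^ card B"
proof -
  interpret P: product_prob_space "\<lambda>_. measure_pmf (bernoulli_pmf p)" V
    by unfold_locales
  define X where "X v = (if v \<in> A then {True} else {False})" for v
  have C: "C = {\<omega> \<in> space (site_perc V p). \<forall>v\<in>A \<union> B. \<omega> v \<in> X v}"
    using AB(5) unfolding C_def X_def by auto
  have "C = prod_emb V (\<lambda>_. measure_pmf (bernoulli_pmf p)) (A \<union> B) (Pi\<^sub>E (A \<union> B) X)"
    unfolding C prod_emb_def site_perc_def using AB by (auto simp: space_PiM Pi_iff)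
  then show "C \<in> sets (site_perc V p)"
    unfolding site_perc_def using AB by (auto intro!: sets_PiM_I)
  have "emeasure (site_perc V p) C = (\<Prod>v\<in>A \<union> B. emeasure (measure_pmf (bernoulli_pmf p)) (X v))"
    unfolding C site_perc_def using AB by (intro P.emeasure_PiM_Collect) auto
  also have "\<dots> = (\<Prod>v\<in>A. emeasure (measure_pmf (bernoulli_pmf p)) (X v)) *
      (\<Prod>v\<in>B. emeasure (measure_pmf (bernoulli_pmf p)) (X v))"
    using AB by (intro prod.union_disjoint)
  also have "(\<Prod>v\<in>A. emeasure (measure_pmf (bernoulli_pmf p)) (X v)) = (\<Prod>v\<in>A. ennreal p)"
    using p by (intro prod.cong) (auto simp: X_def emeasure_pmf_single)
  also have "(\<Prod>v\<in>B. emeasure (measure_pmf (bernoulli_pmf p)) (X v)) = (\<Prod>v\<in>B. ennreal (1 - p))"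
    using p AB(5) by (intro prod.cong) (auto simp: X_def emeasure_pmf_single)
  also have "(\<Prod>v\<in>A. ennreal p) * (\<Prod>v\<in>B. ennreal (1 - p)) = ennreal (p ^ card A * (1 - p) ^ card B)"
    using p by (simp add: ennreal_power ennreal_mult)
  finally show "measure (site_perc V p) C = p ^ card A * (1 - p) ^ card B"
    using p by (simp add: Sigma_Algebra.measure_def)
qed

context percolation_graph
begin

section \<open>Finite clusters of the root and their probabilities\<close>

lemma V_eq_UN_gball: "V = (\<Union>n. gball E r n)"
proof
  show "(\<Union>n. gball E r n) \<subseteq> V" using gball_subset[OF r_in_V] by auto
  show "V \<subseteq> (\<Union>n. gball E r n)"
  proof
    fix v assume "v \<in> V"
    then have "(induced E V)\<^sup>*\<^sup>* r v" using connected r_in_V by (auto simp: connected_on_def)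
    then have "\<exists>n. v \<in> gball E r n"
    proof (induction rule: rtranclp_induct)
      case base
      show ?case by (rule exI[of _ 0]) simp
    next
      case (step y z)
      then obtain n where "y \<in> gball E r n" by blast
      then have "z \<in> gball E r (Suc n)" using step.hyps by (auto simp: induced_def neighbours_def)
      then show ?case ..
    qed
    then show "v \<in> (\<Union>n. gball E r n)" by blast
  qed
qed

text \<open>\<open>V\<close> is a union of finite balls. Countability makes the event of a finite
  nonempty cluster measurable and its probability a limit of finite sums of weights.\<close>

lemma countable_animals: "countable animals"
proof -
  have "countable V"
    unfolding V_eq_UN_gball using finite_card_gball[OF r_in_V]
    by (intro countable_UN) (auto intro: countable_finite)
  then have "countable {S. finite S \<and> S \<subseteq> V}" by (rule countable_Collect_finite_subset)
  then show ?thesis by (rule countable_subset[rotated]) (auto simp: animals_def)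
qed

text \<open>An open walk from \<open>r\<close> cannot leave \<open>S\<close> across a closed
  boundary, and an open connected \<open>S\<close> is reached inside itself. The event thus depends
  on finitely many sites.\<close>

lemma cluster_eq_iff:
  assumes S: "S \<in> animals"
  shows "cluster V E \<omega> r = S \<longleftrightarrow> (\<forall>v\<in>S. \<omega> v) \<and> (\<forall>v\<in>bd S. \<not> \<omega> v)"
proof
  let ?W = "{x \<in> V. \<omega> x}"
  have S': "S \<subseteq> V" "r \<in> S" "connected_on E S" using S by (auto simp: animals_def)
  {
    assume C: "cluster V E \<omega> r = S"
    then have r: "r \<in> ?W" and C': "S = {v. (induced E ?W)\<^sup>*\<^sup>* r v}"
      using S' by (auto simp: cluster_def split: if_splits)
    have "\<omega> v" if "v \<in> S" for v
      using that induced_path_in[of E ?W r v] r C' by auto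
    moreover have "\<not> \<omega> v" if bd: "v \<in> bd S" for v
    proof
      assume v: "\<omega> v"
      obtain u where u: "u \<in> S" "E u v" "v \<in> V" "v \<notin> S" using bd by (auto simp: vertex_boundary_def)
      then have "(induced E ?W)\<^sup>*\<^sup>* r u" "u \<in> ?W"
        using C' induced_path_in[of E ?W r u] r by auto
      moreover have "induced E ?W u v" using u v calculation by (auto simp: induced_def)
      ultimately have "v \<in> S" using C' by (auto intro: rtranclp.rtrancl_into_rtrancl)
      then show False using u by simp
    qed
    ultimately show "(\<forall>v\<in>S. \<omega> v) \<and> (\<forall>v\<in>bd S. \<not> \<omega> v)" by blast
  }
  assume open_closed: "(\<forall>v\<in>S. \<omega> v) \<and> (\<forall>v\<in>bd S. \<not> \<omega> v)"
  then have SW: "S \<subseteq> ?W" using S' by auto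
  have "v \<in> S" if "(induced E ?W)\<^sup>*\<^sup>* r v" for v
    using that
  proof (induction rule: rtranclp_induct)
    case base
    show ?case by fact
  next
    case (step y z)
    then show ?case using open_closed by (auto simp: induced_def vertex_boundary_def)
  qed
  moreover have "(induced E ?W)\<^sup>*\<^sup>* r v" if "v \<in> S" for v
    using that S' induced_mono[OF SW] by (auto simp: connected_on_def)
  ultimately have "{v. (induced E ?W)\<^sup>*\<^sup>* r v} = S" by blast
  then show "cluster V E \<omega> r = S" using SW S'(2) by (auto simp: cluster_def)
qed

lemma cluster_animal:
  assumes "\<omega> r" "finite (cluster V E \<omega> r)"
  shows "cluster V E \<omega> r \<in> animals"
proof -
  let ?W = "{x \<in> V. \<omega> x}" and ?C = "cluster V E \<omega> r"
  have r: "r \<in> ?W" using assms r_in_V by simp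
  have C: "?C = {v. (induced E ?W)\<^sup>*\<^sup>* r v}" using assms r_in_V by (simp add: cluster_def)
  have path: "(induced E ?C)\<^sup>*\<^sup>* r v" if "v \<in> ?C" for v
  proof -
    have "(induced E ?W)\<^sup>*\<^sup>* r v" using that C by simp
    then show ?thesis
    proof (induction rule: rtranclp_induct)
      case (step y z)
      then have "y \<in> ?C" "z \<in> ?C" unfolding C by auto
      then have "induced E ?C y z" using step.hyps by (simp add: induced_def)
      then show ?case using step.IH by simp
    qed simp
  qed
  have "connected_on E ?C"
    unfolding connected_on_def
  proof (intro ballI)
    fix x y assume "x \<in> ?C" "y \<in> ?C"
    then show "(induced E ?C)\<^sup>*\<^sup>* x y"
      by (rule rtranclp_trans[OF induced_sym[OF graph path] path])
  qed
  moreover have "?C \<subseteq> V"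
  proof
    fix v assume "v \<in> ?C"
    then have "(induced E ?W)\<^sup>*\<^sup>* r v" using C by simp
    then have "v \<in> ?W" using r by (rule induced_path_in)
    then show "v \<in> V" by simp
  qed
  moreover have "r \<in> ?C" unfolding C by simp
  ultimately show ?thesis using assms by (simp add: animals_def)
qed

lemma cluster_event:
  assumes S: "S \<in> animals" and p: "0 \<le> p" "p \<le> 1"
  defines "C \<equiv> {\<omega> \<in> space (site_perc V p). cluster V E \<omega> r = S}"
  shows "C \<in> sets (site_perc V p)" and "measure (site_perc V p) C = weight p (1 - p) S"
proof -
  have C: "C = {\<omega> \<in> space (site_perc V p). (\<forall>v\<in>S. \<omega> v) \<and> (\<forall>v\<in>bd S. \<not> \<omega> v)}"
    unfolding C_def cluster_eq_iff[OF S] ..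
  have S': "finite S" "S \<subseteq> V" using S by (auto simp: animals_def)
  have bd: "bd S \<subseteq> V" "S \<inter> bd S = {}" by (auto simp: vertex_boundary_def)
  show "C \<in> sets (site_perc V p)" "measure (site_perc V p) C = weight p (1 - p) S"
    using site_perc_cylinder[OF S'(1) finite_bd[OF S'] S'(2) bd p] unfolding C weight_def by auto
qed

lemma root_open_event:
  assumes p: "0 \<le> p" "p \<le> 1"
  shows "{\<omega> \<in> space (site_perc V p). \<omega> r} \<in> sets (site_perc V p)"
    and "measure (site_perc V p) {\<omega> \<in> space (site_perc V p). \<omega> r} = p"
  using site_perc_cylinder[of "{r}" "{}" V p] r_in_V p by auto

lemma prob_space_site_perc: "prob_space (site_perc V p)"
  unfolding site_perc_def by (intro prob_space_PiM) (simp add: measure_pmf.prob_space_axioms)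

lemma measure_cluster_in:
  assumes p: "0 \<le> p" "p \<le> 1" and F: "finite F" "F \<subseteq> animals"
  defines "C \<equiv> \<Union>S\<in>F. {\<omega> \<in> space (site_perc V p). cluster V E \<omega> r = S}"
  shows "C \<in> sets (site_perc V p)"
    and "measure (site_perc V p) C = (\<Sum>S\<in>F. weight p (1 - p) S)"
proof -
  interpret prob_space "site_perc V p" by (rule prob_space_site_perc)
  have sets: "{\<omega> \<in> space (site_perc V p). cluster V E \<omega> r = S} \<in> events" if "S \<in> F" for S
    using cluster_event(1)[OF _ p] F that by auto
  then show "C \<in> events" unfolding C_def using F by (intro sets.finite_UN) auto
  have "prob C = (\<Sum>S\<in>F. prob {\<omega> \<in> space (site_perc V p). cluster V E \<omega> r = S})"
    unfolding C_def using F sets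
    by (intro finite_measure_finite_Union) (auto simp: disjoint_family_on_def)
  also have "\<dots> = (\<Sum>S\<in>F. weight p (1 - p) S)"
    using cluster_event(2)[OF _ p] F by (intro sum.cong) auto
  finally show "prob C = (\<Sum>S\<in>F. weight p (1 - p) S)" .
qed

lemma cluster_nonempty_root: "r \<in> cluster V E \<omega> r \<Longrightarrow> \<omega> r"
  by (auto simp: cluster_def split: if_splits)

text \<open>The weights are probabilities of disjoint events, each of which forces the root to be
  open.\<close>

lemma sum_weight_le:
  assumes p: "0 \<le> p" "p \<le> 1" and F: "finite F" "F \<subseteq> animals"
  shows "(\<Sum>S\<in>F. weight p (1 - p) S) \<le> p"
proof -
  interpret prob_space "site_perc V p" by (rule prob_space_site_perc)
  have "(\<Union>S\<in>F. {\<omega> \<in> space (site_perc V p). cluster V E \<omega> r = S}) \<subseteq> {\<omega> \<in> space (site_perc V p). \<omega> r}"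
    using F cluster_nonempty_root by (auto simp: animals_def)
  then have "prob (\<Union>S\<in>F. {\<omega> \<in> space (site_perc V p). cluster V E \<omega> r = S}) \<le> p"
    using finite_measure_mono[OF _ root_open_event(1)[OF p]] by (simp only: root_open_event(2)[OF p])
  then show ?thesis using measure_cluster_in(2)[OF p F] by simp
qed

text \<open>Almost surely an open root has an animal as its cluster, so \<open>p\<close>, the
  probability of an open root, is a limit of finite sums of weights.\<close>

lemma le_of_perc_infinite_prob_0:
  assumes p: "0 \<le> p" "p \<le> 1" and zero: "perc_infinite_prob V E r p = 0"
    and bound: "\<And>F. finite F \<Longrightarrow> F \<subseteq> animals \<Longrightarrow> (\<Sum>S\<in>F. weight p (1 - p) S) \<le> c"
  shows "p \<le> c"
proof -
  let ?M = "site_perc V p"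
  interpret prob_space ?M by (rule prob_space_site_perc)
  \<comment> \<open>Nonemptiness lets \<open>from_nat_into\<close> enumerate the animals.
    Repetitions do no harm, since each \<open>C n\<close> is a union over an image.\<close>
  have "{r} \<in> animals" using r_in_V by (auto simp: animals_def connected_on_def)
  then have e: "range (from_nat_into animals) = animals"
    using countable_animals by (intro range_from_nat_into) auto
  let ?e = "from_nat_into animals"
  define C where "C n = (\<Union>S\<in>?e ` {..<n}. {\<omega> \<in> space ?M. cluster V E \<omega> r = S})" for n
  have eF: "finite (?e ` {..<n})" "?e ` {..<n} \<subseteq> animals" for n using e by auto
  have C: "C n \<in> events" "prob (C n) \<le> c" for n
    using measure_cluster_in[OF p eF, of n] bound[OF eF, of n] unfolding C_def by auto
  have "incseq C" unfolding C_def incseq_def by (auto intro: less_le_trans)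
  then have "(\<lambda>n. prob (C n)) \<longlonglongrightarrow> prob (\<Union>n. C n)"
    using C by (intro finite_Lim_measure_incseq) auto
  then have U: "prob (\<Union>n. C n) \<le> c" using C(2) by (intro LIMSEQ_le_const2) auto
  let ?I = "{\<omega> \<in> space ?M. infinite (cluster V E \<omega> r)}"
  let ?R = "{\<omega> \<in> space ?M. \<omega> r}"
  have UC: "(\<Union>n. C n) = {\<omega> \<in> space ?M. cluster V E \<omega> r \<in> animals}"
  proof -
    have "(\<Union>n. ?e ` {..<n}) = range ?e" by auto
    then have "(\<Union>n. ?e ` {..<n}) = animals" using e by simp
    moreover have "(\<Union>n. C n) = (\<Union>S\<in>(\<Union>n. ?e ` {..<n}). {\<omega> \<in> space ?M. cluster V E \<omega> r = S})"
      unfolding C_def by (simp only: UN_UN_flatten)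
    ultimately show ?thesis by auto
  qed
  \<comment> \<open>A closed root has the empty cluster, which is finite. The identity also yields
    measurability of the event of an infinite cluster.\<close>
  have "infinite (cluster V E \<omega> r) \<longleftrightarrow> \<omega> r \<and> cluster V E \<omega> r \<notin> animals" for \<omega>
  proof
    assume inf: "infinite (cluster V E \<omega> r)"
    then have "cluster V E \<omega> r \<noteq> {}" by auto
    then have "\<omega> r" unfolding cluster_def by (simp split: if_splits)
    then show "\<omega> r \<and> cluster V E \<omega> r \<notin> animals" using inf by (simp add: animals_def)
  qed (use cluster_animal in blast)
  then have I: "?I = ?R - (\<Union>n. C n)" unfolding UC by auto
  have "?R \<subseteq> ?I \<union> (\<Union>n. C n)" using I by auto
  moreover have "?I \<in> events" "(\<Union>n. C n) \<in> events"
    unfolding I using C root_open_event(1)[OF p] by auto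
  ultimately have "prob ?R \<le> prob ?I + prob (\<Union>n. C n)"
    by (meson finite_measure_mono measure_Un_le order_trans sets.Un)
  then show ?thesis
    using root_open_event(2)[OF p] U zero by (simp add: perc_infinite_prob_def)
qed

text \<open>One \<open>\<delta>\<close> serves all \<open>p\<close>, so that the strict inequality
  survives the supremum in \<open>site_pc\<close>.\<close>

lemma zero_percolation_bound:
  fixes h :: real
  assumes h: "0 < h"
    and iso: "\<And>S. finite S \<Longrightarrow> S \<noteq> {} \<Longrightarrow> S \<subseteq> V \<Longrightarrow> h * card S \<le> card (bd S)"
  shows "\<exists>\<delta>>0. \<forall>p. 0 \<le> p \<longrightarrow> p \<le> 1 \<longrightarrow> perc_infinite_prob V E r p = 0 \<longrightarrow> p \<le> 1 / (1 + h) - \<delta>"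
proof -
  define p0 where "p0 = 1 / (1 + h)"
  have p0: "0 < p0" "p0 < 1" using h by (auto simp: p0_def)
  define b where "b = (D + 1) ^ Suc k"
  \<comment> \<open>\<open>K\<close> must be fixed before \<open>\<alpha>\<close> and
    \<open>\<delta>\<close>, which depend on it. It rests on the lower bound
    \<open>p0 / 4 * (1 - p0)\<close> for \<open>x * (1 - p)\<close>, where \<open>p0 / 4\<close>
    comes from \<open>p > p0 / 2\<close> and \<open>\<alpha> \<le> 2\<close>.\<close>
  define K where "K = 2 ^ b / (p0 / 4 * (1 - p0)) ^ b"
  have K: "0 < K" using p0 by (simp add: K_def)
  obtain N0 :: nat where "(1 + h) / (h * K) < N0" using reals_Archimedean2 by blast
  \<comment> \<open>Large enough both for the derivative condition of \<open>tilt_parameters\<close>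
    and for the density of separated sets.\<close>
  define N where "N = max N0 ((D + 1) ^ k)"
  have "(1 + h) / (h * K) < N" using \<open>(1 + h) / (h * K) < N0\<close> by (simp add: N_def)
  then have N: "1 + h < h * K * N" "(D + 1) ^ k \<le> N"
    using h K by (simp_all add: N_def divide_less_eq mult.commute)
  define s where "s a = (1 + K * (a ^ N - 1)) powr (1 / (1 + h))" for a :: real
  obtain \<alpha> \<delta> where \<alpha>: "1 < \<alpha>" "\<alpha> \<le> 2" and \<delta>: "0 < \<delta>" "\<delta> \<le> p0 / 2"
    and q1: "\<And>p. p0 - \<delta> < p \<Longrightarrow> p \<le> p0 \<Longrightarrow> p / \<alpha> * s \<alpha> powr - h \<le> 1 - (1 - p) * s \<alpha>"
    and q2: "\<And>p. p0 - \<delta> < p \<Longrightarrow> p \<le> p0 \<Longrightarrow> \<alpha> * (1 - (1 - p) * s \<alpha>) < p"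
    using tilt_parameters[OF h K N(1)] unfolding p0_def s_def by metis
  define \<beta> where "\<beta> = 1 + K * (\<alpha> ^ N - 1)"
  have \<beta>: "1 \<le> \<beta>" using K \<alpha> by (simp add: \<beta>_def one_le_power)
  have s: "1 \<le> s \<alpha>" "\<beta> = s \<alpha> powr (1 + h)"
    using \<beta> h by (auto simp: s_def \<beta>_def[symmetric] powr_powr ge_one_powr_ge_zero)
  have animal: "finite S" "S \<noteq> {}" "S \<subseteq> V" "h * card S + (1 + h) * card (holes S) \<le> card (bd S)"
    if "S \<in> animals" for S
    using that bd_holes_ge[OF iso, of S] by (auto simp: animals_def)
  have "p \<le> p0 - \<delta>" if p: "0 \<le> p" "p \<le> 1" and zero: "perc_infinite_prob V E r p = 0" for p
  proof (rule ccontr)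
    assume "\<not> p \<le> p0 - \<delta>"
    then have p\<delta>: "p0 - \<delta> < p" by simp
    show False
    proof (cases "p \<le> p0")
      case True
      \<comment> \<open>Chosen so that \<open>1 - q = (1 - p) * s \<alpha>\<close>: the boundary
        factor tilted by \<open>s \<alpha>\<close> is that of percolation at
        \<open>q\<close>.\<close>
      define q where "q = 1 - (1 - p) * s \<alpha>"
      define x where "x = p / \<alpha>"
      have "p0 / 2 < p" using p\<delta> \<delta> by simp
      then have p2: "0 < p" using p0 by simp
      have x: "0 < x" "x \<le> 1" using \<alpha> p p2 by (auto simp: x_def field_simps)
      have y: "0 < 1 - p" "1 - p \<le> 1" using True p p0 by auto
      have xq: "x * s \<alpha> powr - h \<le> q" using q1[OF p\<delta> True] by (simp add: x_def q_def)
      have "0 \<le> x * s \<alpha> powr - h" using x by simp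
      then have q: "0 \<le> q" "q \<le> 1" using xq y s by (auto simp: q_def)
      have "\<alpha> * p0 \<le> 2 * p0" using \<alpha> p0 by simp
      then have "p0 / 4 \<le> x" using \<alpha> \<open>p0 / 2 < p\<close> by (simp add: x_def field_simps)
      then have "p0 / 4 * (1 - p0) \<le> x * (1 - p)" using True p0 x by (intro mult_mono) auto
      then have "(p0 / 4 * (1 - p0)) ^ b \<le> (x * (1 - p)) ^ b" using p0 by (intro power_mono) auto
      then have Kx: "2 ^ b / (x * (1 - p)) ^ b \<le> K"
        unfolding K_def using p0 x y by (intro divide_left_mono) auto
      have tilt: "weight x (1 - p) S * \<beta> ^ card (holes S) \<le> weight q (1 - q) S" if S: "S \<in> animals" for S
      proof -
        have "\<beta> ^ card (holes S) = \<beta> powr card (holes S)"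
          using \<beta> by (simp add: powr_realpow)
        also have "\<dots> = s \<alpha> powr ((1 + h) * card (holes S))"
          unfolding s(2) by (rule powr_powr)
        \<comment> \<open>Since \<open>s \<alpha> \<ge> 1\<close>, the isoperimetric bound with
          holes trades the number of holes for powers attached to \<open>bd S\<close> and to
          \<open>S\<close>.\<close>
        also have "\<dots> \<le> s \<alpha> powr (card (bd S) + - h * card S)"
          using animal(4)[OF S] s by (intro powr_mono) auto
        also have "\<dots> = s \<alpha> ^ card (bd S) * (s \<alpha> powr - h) ^ card S"
        proof -
          have 1: "s \<alpha> powr (- h * card S) = (s \<alpha> powr - h) ^ card S"
            unfolding powr_powr[symmetric] using s by (intro powr_realpow) auto
          have 2: "s \<alpha> powr card (bd S) = s \<alpha> ^ card (bd S)"
            using s by (intro powr_realpow) auto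
          show ?thesis by (simp only: powr_add 1 2)
        qed
        finally have "weight x (1 - p) S * \<beta> ^ card (holes S) \<le>
            weight x (1 - p) S * (s \<alpha> ^ card (bd S) * (s \<alpha> powr - h) ^ card S)"
          using x y by (intro mult_left_mono) (auto simp: weight_def)
        also have "\<dots> = (x * s \<alpha> powr - h) ^ card S * (1 - q) ^ card (bd S)"
          by (simp add: weight_def q_def power_mult_distrib mult_ac)
        also have "\<dots> \<le> weight q (1 - q) S"
          unfolding weight_def using xq x q by (intro mult_right_mono power_mono) auto
        finally show ?thesis .
      qed
      have "p \<le> \<alpha> * q"
      proof (rule le_of_perc_infinite_prob_0[OF p zero])
        fix F assume F: "finite F" "F \<subseteq> animals"
        obtain F' where "finite F' \<and> F' \<subseteq> animals \<and>
          (\<Sum>S\<in>F. weight x (1 - p) S * \<alpha> ^ (card S - 1)) \<le>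
            (\<Sum>S\<in>F'. weight x (1 - p) S * \<beta> ^ card (holes S))"
          using sum_weight_le_sum_holes[OF x y less_imp_le[OF \<alpha>(1)] N(2) Kx[unfolded b_def] F,
              folded \<beta>_def] ..
        then have F': "finite F'" "F' \<subseteq> animals"
          "(\<Sum>S\<in>F. weight x (1 - p) S * \<alpha> ^ (card S - 1)) \<le>
            (\<Sum>S\<in>F'. weight x (1 - p) S * \<beta> ^ card (holes S))"
          by simp_all
        \<comment> \<open>The exponent \<open>card S - 1\<close> reflects that the root is never
          punched; the remaining factor \<open>\<alpha>\<close> is the one in
          \<open>\<alpha> * q\<close>.\<close>
        have "weight p (1 - p) S = \<alpha> * (weight x (1 - p) S * \<alpha> ^ (card S - 1))" if "S \<in> F" for S
        proof -
          have "S \<in> animals" using that F by auto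
          then have "card S \<noteq> 0" using animal(1,2)[of S] by simp
          then have "\<alpha> * \<alpha> ^ (card S - 1) = \<alpha> ^ card S" by (simp add: power_eq_if)
          moreover have "p ^ card S = x ^ card S * \<alpha> ^ card S"
            using \<alpha> by (simp add: x_def power_mult_distrib[symmetric])
          ultimately show ?thesis by (simp add: weight_def mult_ac)
        qed
        then have "(\<Sum>S\<in>F. weight p (1 - p) S) = \<alpha> * (\<Sum>S\<in>F. weight x (1 - p) S * \<alpha> ^ (card S - 1))"
          unfolding sum_distrib_left by (intro sum.cong) auto
        also have "\<dots> \<le> \<alpha> * (\<Sum>S\<in>F'. weight x (1 - p) S * \<beta> ^ card (holes S))"
          using F'(3) \<alpha> by (intro mult_left_mono) auto
        also have "\<dots> \<le> \<alpha> * (\<Sum>S\<in>F'. weight q (1 - q) S)"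
          using \<alpha> F'(2) tilt by (intro mult_left_mono sum_mono) auto
        also have "\<dots> \<le> \<alpha> * q"
          using sum_weight_le[OF q F'(1,2)] \<alpha> by (intro mult_left_mono) auto
        finally show "(\<Sum>S\<in>F. weight p (1 - p) S) \<le> \<alpha> * q" .
      qed
      then show False using q2[OF p\<delta> True] by (simp add: q_def)
    next
      case False
      \<comment> \<open>Above \<open>p0\<close> the direct comparison with the weights at
        \<open>p0\<close> suffices.\<close>
      have "p \<le> p0"
      proof (rule le_of_perc_infinite_prob_0[OF p zero])
        fix F assume F: "finite F" "F \<subseteq> animals"
        have "(\<Sum>S\<in>F. weight p (1 - p) S) \<le> (\<Sum>S\<in>F. weight p0 (1 - p0) S)"
        proof (rule sum_mono)
          fix S assume "S \<in> F"
          then have "S \<in> animals" using F(2) by blast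
          then have "h * card S \<le> card (bd S)" by (intro iso animal)
          then show "weight p (1 - p) S \<le> weight p0 (1 - p0) S"
            unfolding weight_def p0_def using False p h
            by (intro weight_decreasing) (auto simp: p0_def)
        qed
        also have "\<dots> \<le> p0" using sum_weight_le[OF _ _ F, of p0] p0 by simp
        finally show "(\<Sum>S\<in>F. weight p (1 - p) S) \<le> p0" .
      qed
      then show False using False by simp
    qed
  qed
  then show ?thesis using \<delta>(1) unfolding p0_def by blast
qed

text \<open>Shows that the supremum in \<open>site_pc\<close> is over a nonempty set.\<close>

lemma perc_infinite_prob_zero: "perc_infinite_prob V E r 0 = 0"
proof -
  interpret prob_space "site_perc V 0" by (rule prob_space_site_perc)
  have "perc_infinite_prob V E r 0 \<le> prob {\<omega> \<in> space (site_perc V 0). \<omega> r}"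
    unfolding perc_infinite_prob_def using root_open_event(1)[of 0]
    by (intro finite_measure_mono) (auto simp: cluster_def)
  then show ?thesis
    using root_open_event(2)[of 0] by (simp add: perc_infinite_prob_def antisym)
qed

lemma site_pc_less:
  fixes h :: real
  assumes h: "0 < h"
    and iso: "\<And>S. finite S \<Longrightarrow> S \<noteq> {} \<Longrightarrow> S \<subseteq> V \<Longrightarrow> h * card S \<le> card (bd S)"
  shows "site_pc V E r < 1 / (h + 1)"
proof -
  obtain \<delta> where \<delta>: "\<delta> > 0"
    "\<And>p. 0 \<le> p \<Longrightarrow> p \<le> 1 \<Longrightarrow> perc_infinite_prob V E r p = 0 \<Longrightarrow> p \<le> 1 / (1 + h) - \<delta>"
    using zero_percolation_bound[OF assms] by blast
  have "site_pc V E r \<le> 1 / (1 + h) - \<delta>"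
    unfolding site_pc_def
  proof (rule cSup_least)
    show "{p \<in> {0..1}. perc_infinite_prob V E r p = 0} \<noteq> {}"
      using perc_infinite_prob_zero by (auto intro: exI[of _ 0])
  qed (use \<delta>(2) in auto)
  then show ?thesis using \<delta>(1) by (simp add: add.commute)
qed

end

section \<open>Vertex and edge Cheeger constants, and the conclusion\<close>

lemma h_V_le:
  assumes "finite S" "S \<noteq> {}" "S \<subseteq> V"
  shows "h_V V E * card S \<le> card (vertex_boundary V E S)"
proof -
  have "h_V V E \<le> card (vertex_boundary V E S) / card S"
    unfolding h_V_def by (rule cInf_lower) (use assms in \<open>auto intro!: bdd_belowI[of _ 0]\<close>)
  then show ?thesis using assms by (simp add: le_divide_eq card_gt_0_iff)
qed

text \<open>Every boundary edge ends in the vertex boundary, and at most \<open>D\<close> of them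
  end at any one vertex. Dividing by \<open>D + 1\<close> avoids a division by zero for
  \<open>D = 0\<close>.\<close>

lemma h_V_pos:
  assumes gr: "graph V E" and "V \<noteq> {}" and na: "nonamenable V E"
    and deg: "\<And>v. v \<in> V \<Longrightarrow> finite (neighbours E v) \<and> card (neighbours E v) \<le> D"
  shows "0 < h_V V E"
proof -
  have hE: "0 < h_E V E" using na by (simp add: nonamenable_def)
  have "h_E V E / (D + 1) \<le> h_V V E"
    unfolding h_V_def
  proof (rule cInf_greatest)
    obtain v where "v \<in> V" using \<open>V \<noteq> {}\<close> by blast
    then show "{real (card (vertex_boundary V E S)) / card S | S. S \<subseteq> V \<and> finite S \<and> S \<noteq> {}} \<noteq> {}"
      by (auto intro!: exI[of _ "{v}"])
    fix x assume "x \<in> {real (card (vertex_boundary V E S)) / card S | S. S \<subseteq> V \<and> finite S \<and> S \<noteq> {}}"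
    then obtain S where S: "x = card (vertex_boundary V E S) / card S" "S \<subseteq> V" "finite S" "S \<noteq> {}"
      by blast
    let ?B = "vertex_boundary V E S"
    have "?B \<subseteq> (\<Union>u\<in>S. neighbours E u)" by (auto simp: vertex_boundary_def neighbours_def)
    then have finB: "finite ?B" using S deg by (meson finite_UN finite_subset subsetD)
    have BV: "?B \<subseteq> V" by (auto simp: vertex_boundary_def)
    have sub: "edge_boundary E S \<subseteq> (\<Union>v\<in>?B. neighbours E v \<times> {v})"
      using gr by (auto simp: edge_boundary_def vertex_boundary_def neighbours_def graph_def)
    have "card (edge_boundary E S) \<le> card (\<Union>v\<in>?B. neighbours E v \<times> {v})"
      using finB BV deg by (intro card_mono[OF _ sub]) auto
    also have "\<dots> \<le> (\<Sum>v\<in>?B. card (neighbours E v \<times> {v}))" using finB by (rule card_UN_le)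
    also have "\<dots> \<le> (\<Sum>v\<in>?B. D + 1)" using BV deg by (intro sum_mono) (auto simp: card_cartesian_product le_SucI)
    finally have le: "card (edge_boundary E S) \<le> card ?B * (D + 1)" by simp
    have "h_E V E \<le> card (edge_boundary E S) / card S"
      unfolding h_E_def by (rule cInf_lower) (use S in \<open>auto intro!: bdd_belowI[of _ 0]\<close>)
    also have "\<dots> \<le> real (card ?B * (D + 1)) / card S"
      using le by (intro divide_right_mono of_nat_mono) auto
    also have "\<dots> = x * (D + 1)" by (simp add: S(1) distrib_left add_divide_distrib)
    finally show "h_E V E / (D + 1) \<le> x" by (simp add: divide_le_eq)
  qed
  moreover have "0 < h_E V E / (D + 1)" using hE by simp
  ultimately show ?thesis by linarith
qed

theorem theorem8p2:
  fixes V :: "'a set" and E :: "'a \<Rightarrow> 'a \<Rightarrow> bool" and r :: 'a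
  assumes "graph V E"
    and "infinite V"
    and "connected_on E V"
    and "bounded_degree V E"
    and "one_ended V E"
    and "two_connected V E"
    and "nonamenable V E"
    and "cycle_space_bounded_gen E"
    and "r \<in> V"
  shows "site_pc V E r < 1 / (h_V V E + 1)"
proof -
  obtain D where D: "\<And>v. v \<in> V \<Longrightarrow> finite (neighbours E v) \<and> card (neighbours E v) \<le> D"
    using assms(4) by (auto simp: bounded_degree_def)
  obtain k where k: "cycle_space E = z2span {cycle_edges cs | cs. is_cycle E cs \<and> length cs \<le> k}"
    using assms(8) unfolding cycle_space_bounded_gen_def ..
  \<comment> \<open>The radius \<open>Suc k\<close> is positive even for \<open>k = 0\<close>, as
    the locale asks.\<close>
  have local: "(induced E (gball E v (Suc k) - {v}))\<^sup>*\<^sup>* a b" if v: "v \<in> V" "E v a" "E v b" for v a b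
  proof (rule induced_mono)
    show "gball E v k - {v} \<subseteq> gball E v (Suc k) - {v}" by auto
    show "(induced E (gball E v k - {v}))\<^sup>*\<^sup>* a b"
      using assms(6) D[OF v(1)] v
      by (intro neighbours_connected_in_ball[OF assms(1) _ _ k]) (auto simp: two_connected_def)
  qed
  interpret percolation_graph V E r D "Suc k"
    by unfold_locales (use assms(1,2,3,9) D in \<open>simp_all add: local del: gball.simps\<close>)
  have "V \<noteq> {}" using assms(9) by blast
  then show ?thesis
    using h_V_pos[OF assms(1) _ assms(7) D] by (intro site_pc_less h_V_le)
qed

end
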